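(* For rotationally symmetric hypersurfaces in $H_n$ with constant $p$-mean curvature $H=c>0$, the energy $E$ has the lower bound $$E\ \ge\ \frac{-1}{2n}\left(\frac{2n-1}{c}\right)^{2n-1}.$$ This lower bound is optimal. For any such value $E$ (that is, any $E$ satisfying this inequality), there exists a unique reflective rotationally symmetric hypersurface with constant $p$-mean curvature $H=c$ and with $E$ as its energy. The corresponding generating curve is $$x(\tilde s)=F_E(\tilde s),\qquad t(\tilde s)=-\int\left(\frac{c}{2n}-\frac{E}{x^{2n}}\right)x^2\,d\tilde s .$$ Here the horizontal arc-length $\tilde s=G_E(x)$ is defined as the anti-derivative, with respect to $x$, of the function $$\pm\frac{1}{\sqrt{1-x^2\left(\frac{E}{x^{2n}}-\frac{c}{2n}\right)^2}},$$ for all $x\in(a,b)$, an interval depending on $E$, and $F_E(\tilde s)$ is the inverse of $G_E(x)$.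
   Context: Here $n\ge1$. The Heisenberg group $H_n$ is $\mathbb R^{2n+1}$ with coordinates $(x_1,\dots,x_n,y_1,\dots,y_n,t)$, $z=(x_1+iy_1,\dots,x_n+iy_n)$, contact form $\Theta=dt+\sum_{j}(x_jdy_j-y_jdx_j)$, contact bundle $\xi=\ker\Theta$, and left-invariant fields $\mathring e_\beta=\partial_{x_\beta}+y_\beta\partial_t$, $\mathring e_{n+\beta}=\partial_{y_\beta}-x_\beta\partial_t$, $T=\partial_t$. $J\mathring e_\beta=\mathring e_{n+\beta}$, $J\mathring e_{n+\beta}=-\mathring e_\beta$; the Levi metric $G$ on $\xi$ makes $\mathring e_1,\dots,\mathring e_{2n}$ orthonormal; $\nabla$ is the pseudohermitian connection, for which all $\mathring e_a$ and $T$ are parallel. $U(n)$ acts by $(z,t)\mapsto(Az,t)$. A rotationally symmetric hypersurface is one invariant under $U(n)$; it is generated by a curve $(x(s),t(s))$ in the $x_nt$-plane, where $x=|z|$, and the quantities below are considered where $x>0$. The corresponding horizontal generating curve is $\tilde\gamma(s)=(0,\dots,0,x\cos\theta(s),0,\dots,0,x\sin\theta(s),t(s))$ with $\theta'=-t'/x^2$, so that $\tilde\gamma'\in\xi$; the horizontal arc-length $\tilde s$ is the parameter with $|\tilde\gamma'|_G=1$, i.e. $(dx/d\tilde s)^2+x^{-2}(dt/d\tilde s)^2=1$. Generating curves are determined up to translation along the $t$-axis. Invariants. Let $\xi'=(\xi\cap T\Sigma)\cap J(\xi\cap T\Sigma)$, let $e_n\in\xi\cap T\Sigma$ be the unit vector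 $G$-orthogonal to $\xi'$ with orientation given by $\tilde\gamma'$, and $e_{2n}=Je_n$. Define $\alpha$ by $\alpha e_{2n}+T\in T\Sigma$, $l$ by $-\nabla_{e_n}e_{2n}=l\,e_n$, and, for $n\ge2$, $k$ as the common eigenvalue on $\xi'$ of $v\mapsto-\nabla_ve_{2n}+\alpha Jv$ (it exists for rotationally symmetric hypersurfaces); in terms of the generating curve $k=\frac{-t'}{x\sqrt{(xx')^2+(t')^2}}$, and for $n=1$ this formula is taken as the definition of $k$. The $p$-mean curvature is $H=l+(2n-2)k$. Energy. If $H=2n\lambda=c$ is constant, the energy is $E=(\lambda-k)x^{2n}=\frac{x^{2n-1}t'}{\sqrt{(xx')^2+(t')^2}}+\lambda x^{2n}$; it is constant along the generating curve. Reflective: where $\alpha\neq0$ write the hypersurface via $t^2=f(r)$, $r=|z|^2$. A reflective rotationally symmetric hypersurface is a union $\Sigma=\Sigma^+\cup\Sigma^-$ of two (possibly disjoint) parts $\Sigma^\pm=\{t=\pm\sqrt{f}\}$, interchanged by the reflection in the hyperplane $t=0$. The generating curve of $\Sigma$ consists of two parts $\gamma^\pm$, one for $\Sigma^+$ and one for $\Sigma^-$; the two signs $\pm$ in the claim correspond to these two parts. The vertical cylinder $\{|z|=\mathrm{const}\}$ ($\alpha\equiv0$) is itself symmetric under the reflection. *)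

theory Defs
  imports "HOL-Analysis.Analysis"
begin

section \<open>The Heisenberg group\<close>

text \<open>
  A point is \<open>(z, t)\<close> with \<open>z = x + \<i> y\<close> in \<open>\<complex>\<^sup>n\<close>, \<open>n = CARD('n)\<close>. Tangent vectors are written in the
  Cartesian coordinates of the same space.
\<close>

type_synonym 'n heis = "(complex ^ 'n) \<times> real"

definition contact_form :: "'n::finite heis \<Rightarrow> 'n heis \<Rightarrow> real" where
  "contact_form p v = snd v + (\<Sum>j\<in>UNIV. Re (fst p $ j) * Im (fst v $ j) - Im (fst p $ j) * Re (fst v $ j))"

definition e_x :: "'n::finite \<Rightarrow> 'n heis \<Rightarrow> 'n heis" where
  "e_x j p = (axis j 1, Im (fst p $ j))"

definition e_y :: "'n::finite \<Rightarrow> 'n heis \<Rightarrow> 'n heis" where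
  "e_y j p = (axis j \<i>, - Re (fst p $ j))"

definition T_field :: "'n::finite heis" where
  "T_field = (0, 1)"

text \<open>
  The horizontal vector at \<open>p\<close> whose coefficients in the frame \<open>e_x j\<close>, \<open>e_y j\<close> are the real and imaginary
  parts of \<open>w $ j\<close>. By \<open>horiz_fst\<close> below, the frame coefficients of a horizontal vector \<open>v\<close> are
  given in this way by \<open>fst v\<close>; hence \<open>J\<close> is multiplication of \<open>fst v\<close> by \<open>\<i>\<close>, and the Levi metric is the
  real inner product of the first components.
\<close>

definition horiz :: "'n::finite heis \<Rightarrow> complex ^ 'n \<Rightarrow> 'n heis" where
  "horiz p w = (\<Sum>j\<in>UNIV. Re (w $ j) *\<^sub>R e_x j p + Im (w $ j) *\<^sub>R e_y j p)"

definition J_op :: "'n::finite heis \<Rightarrow> 'n heis \<Rightarrow> 'n heis" where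
  "J_op p v = horiz p (\<i> *s fst v)"

definition levi :: "'n::finite heis \<Rightarrow> 'n heis \<Rightarrow> real" where
  "levi v w = inner (fst v) (fst w)"

lemma fst_horiz [simp]: "fst (horiz p w) = w"
  by (simp add: horiz_def e_x_def e_y_def fst_sum vec_eq_iff sum_component axis_def
      complex_eq_iff if_distrib sum.distrib cong: if_cong)

lemma snd_horiz: "snd (horiz p w) = (\<Sum>j\<in>UNIV. Re (w $ j) * Im (fst p $ j) - Im (w $ j) * Re (fst p $ j))"
  by (simp add: horiz_def e_x_def e_y_def snd_sum)

lemma contact_form_horiz: "contact_form p (horiz p w) = 0"
  by (simp add: contact_form_def snd_horiz sum.distrib[symmetric] algebra_simps)

lemma horiz_fst: "contact_form p v = 0 \<Longrightarrow> horiz p (fst v) = v"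
proof -
  assume a: "contact_form p v = 0"
  have "snd (horiz p (fst v)) + (\<Sum>j\<in>UNIV. Re (fst p $ j) * Im (fst v $ j) - Im (fst p $ j) * Re (fst v $ j)) = 0"
    by (simp add: snd_horiz sum.distrib[symmetric] algebra_simps)
  with a show ?thesis
    by (simp add: contact_form_def prod_eq_iff)
qed

lemma horiz_axis: "horiz p (axis j 1) = e_x j p" "horiz p (axis j \<i>) = e_y j p"
proof -
  have "contact_form p (e_x j p) = 0" "contact_form p (e_y j p) = 0"
    by (simp_all add: contact_form_def e_x_def e_y_def axis_def if_distrib if_distribR sum.distrib sum_subtractf cong: if_cong)
  from this[THEN horiz_fst]
  show "horiz p (axis j 1) = e_x j p" "horiz p (axis j \<i>) = e_y j p"
    by (simp_all add: e_x_def e_y_def)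
qed

lemma J_op_frame: "J_op p (e_x j p) = e_y j p" "J_op p (e_y j p) = - e_x j p"
proof -
  have a: "\<i> *s axis j 1 = (axis j \<i> :: complex ^ 'n)" and b: "\<i> *s axis j \<i> = - (axis j 1 :: complex ^ 'n)" for j
    by (simp_all add: vec_eq_iff axis_def)
  have c: "horiz p (- w) = - horiz p w" for w
    by (simp add: horiz_def sum_negf[symmetric])
  show "J_op p (e_x j p) = e_y j p" "J_op p (e_y j p) = - e_x j p"
    by (simp_all only: J_op_def e_x_def[of j] e_y_def[of j] fst_conv a b c)
       (simp_all add: horiz_axis e_x_def e_y_def)
qed

lemma levi_frame:
  "levi (e_x i p) (e_x j p) = of_bool (i = j)" "levi (e_y i p) (e_y j p) = of_bool (i = j)"
  "levi (e_x i p) (e_y j p) = 0"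
  by (simp_all add: levi_def e_x_def e_y_def inner_axis_axis inner_complex_def)


section \<open>Immersed hypersurfaces\<close>

text \<open>
  A hypersurface is given by an immersion \<open>\<Phi>\<close> of \<open>M\<close>; vector fields along it are functions on \<open>M\<close>.
  \<open>curve_through M \<Phi> q v g\<close>: the curve \<open>g\<close> in \<open>M\<close> starts at \<open>q\<close>, and its image has initial velocity \<open>v\<close>.
\<close>

definition curve_through ::
  "'m::real_normed_vector set \<Rightarrow> ('m \<Rightarrow> 'n::finite heis) \<Rightarrow> 'm \<Rightarrow> 'n heis \<Rightarrow> (real \<Rightarrow> 'm) \<Rightarrow> bool" where
  "curve_through M \<Phi> q v g \<longleftrightarrow>
     g 0 = q \<and> (\<forall>\<^sub>F \<epsilon> in nhds 0. g \<epsilon> \<in> M) \<and> g differentiable (at 0) \<and>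
     ((\<lambda>\<epsilon>. \<Phi> (g \<epsilon>)) has_vector_derivative v) (at 0)"

definition tangent_sp :: "'m::real_normed_vector set \<Rightarrow> ('m \<Rightarrow> 'n::finite heis) \<Rightarrow> 'm \<Rightarrow> 'n heis set" where
  "tangent_sp M \<Phi> q = {v. \<exists>g. curve_through M \<Phi> q v g}"

definition contact_tangent :: "'m::real_normed_vector set \<Rightarrow> ('m \<Rightarrow> 'n::finite heis) \<Rightarrow> 'm \<Rightarrow> 'n heis set" where
  "contact_tangent M \<Phi> q = {v \<in> tangent_sp M \<Phi> q. contact_form (\<Phi> q) v = 0}"

definition xi' :: "'m::real_normed_vector set \<Rightarrow> ('m \<Rightarrow> 'n::finite heis) \<Rightarrow> 'm \<Rightarrow> 'n heis set" where
  "xi' M \<Phi> q = contact_tangent M \<Phi> q \<inter> J_op (\<Phi> q) ` contact_tangent M \<Phi> q"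

text \<open>
  Pseudohermitian connection, for which the frame \<open>e_x j\<close>, \<open>e_y j\<close> is parallel: the derivative in the
  direction \<open>v\<close> of a horizontal field \<open>V\<close> along \<open>\<Phi>\<close> differentiates the frame coefficients \<open>fst V\<close>.
\<close>

definition has_cov_deriv ::
  "'m::real_normed_vector set \<Rightarrow> ('m \<Rightarrow> 'n::finite heis) \<Rightarrow> 'm \<Rightarrow> 'n heis \<Rightarrow> ('m \<Rightarrow> 'n heis) \<Rightarrow> 'n heis \<Rightarrow> bool" where
  "has_cov_deriv M \<Phi> q v V D \<longleftrightarrow>
     (\<exists>w. D = horiz (\<Phi> q) w \<and>
          (\<forall>g. curve_through M \<Phi> q v g \<longrightarrow> ((\<lambda>\<epsilon>. fst (V (g \<epsilon>))) has_vector_derivative w) (at 0)))"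


section \<open>Rotationally symmetric hypersurfaces\<close>

definition C2_on :: "real set \<Rightarrow> (real \<Rightarrow> real) \<Rightarrow> bool" where
  "C2_on I f \<longleftrightarrow> (\<forall>s\<in>I. f field_differentiable (at s) \<and> deriv f field_differentiable (at s)) \<and>
                continuous_on I (deriv (deriv f))"

text \<open>
  The hypersurface generated by the curve \<open>(x s, t s)\<close>, \<open>s \<in> I\<close>, is the image of \<open>I\<close> times the unit sphere of
  \<open>\<complex>\<^sup>n\<close> (the orbit of the last coordinate vector under \<open>U(n)\<close>). It may have self-intersections.
\<close>

definition rot_dom :: "real set \<Rightarrow> (real \<times> (complex ^ 'n::finite)) set" where
  "rot_dom I = I \<times> sphere 0 1"

definition rot_map :: "(real \<Rightarrow> real) \<Rightarrow> (real \<Rightarrow> real) \<Rightarrow> real \<times> (complex ^ 'n::finite) \<Rightarrow> 'n heis" where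
  "rot_map x t q = (x (fst q) *\<^sub>R snd q, t (fst q))"

definition generates :: "real set \<Rightarrow> (real \<Rightarrow> real) \<Rightarrow> (real \<Rightarrow> real) \<Rightarrow> 'n::finite heis set \<Rightarrow> bool" where
  "generates I x t S \<longleftrightarrow>
     open I \<and> is_interval I \<and> I \<noteq> {} \<and> C2_on I x \<and> C2_on I t \<and>
     (\<forall>s\<in>I. x s > 0 \<and> (deriv x s, deriv t s) \<noteq> (0, 0)) \<and>
     S = rot_map x t ` rot_dom I"

definition unitary :: "complex ^ 'n ^ 'n::finite \<Rightarrow> bool" where
  "unitary A \<longleftrightarrow> (\<chi> i j. cnj (A $ j $ i)) ** A = mat 1"

lemma unitary_norm:
  assumes "unitary A"
  shows "norm (A *v z) = norm z"
proof -
  have sq: "complex_of_real ((norm w)\<^sup>2) = (\<Sum>i\<in>UNIV. cnj (w $ i) * (w $ i))" for w :: "complex ^ 'n"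
    by (simp add: norm_vec_def L2_set_def sum_nonneg real_sqrt_pow2 complex_norm_square[symmetric] mult.commute[of "cnj _"])
  let ?B = "\<chi> i j. cnj (A $ j $ i)"
  have cA: "cnj ((A *v z) $ i) = (\<Sum>j\<in>UNIV. cnj (z $ j) * cnj (A $ i $ j))" for i
    by (simp add: matrix_vector_mult_def mult.commute)
  have "(\<Sum>i\<in>UNIV. cnj ((A *v z) $ i) * ((A *v z) $ i))
      = (\<Sum>i\<in>UNIV. \<Sum>j\<in>UNIV. cnj (z $ j) * (cnj (A $ i $ j) * ((A *v z) $ i)))"
    by (simp add: cA sum_distrib_right mult.assoc)
  also have "\<dots> = (\<Sum>j\<in>UNIV. \<Sum>i\<in>UNIV. cnj (z $ j) * (cnj (A $ i $ j) * ((A *v z) $ i)))"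
    by (rule sum.swap)
  also have "\<dots> = (\<Sum>j\<in>UNIV. cnj (z $ j) * ((?B *v (A *v z)) $ j))"
    by (simp add: matrix_vector_mult_def[of ?B] sum_distrib_left)
  also have "\<dots> = (\<Sum>j\<in>UNIV. cnj (z $ j) * (z $ j))"
    using assms by (simp add: unitary_def matrix_vector_mul_assoc)
  finally have "(norm (A *v z))\<^sup>2 = (norm z)\<^sup>2"
    by (metis sq of_real_eq_iff)
  then show ?thesis by simp
qed

lemma rot_image: 
  assumes "\<And>s. s \<in> I \<Longrightarrow> x s > 0"
  shows "rot_map x t ` rot_dom I = {(z, \<tau>). \<exists>s\<in>I. norm z = x s \<and> \<tau> = t s}"
proof (intro equalityI subsetI)
  fix p :: "'a heis" assume "p \<in> rot_map x t ` rot_dom I"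
  then show "p \<in> {(z, \<tau>). \<exists>s\<in>I. norm z = x s \<and> \<tau> = t s}"
    using assms by (fastforce simp: rot_map_def rot_dom_def)
next
  fix p :: "'a heis" assume "p \<in> {(z, \<tau>). \<exists>s\<in>I. norm z = x s \<and> \<tau> = t s}"
  then obtain z s where p: "p = (z, t s)" "s \<in> I" "norm z = x s" by auto
  have "x s > 0" using p assms by simp
  then have "p = rot_map x t (s, z /\<^sub>R x s)" "(s, z /\<^sub>R x s) \<in> rot_dom I"
    using p by (simp_all add: rot_map_def rot_dom_def)
  then show "p \<in> rot_map x t ` rot_dom I" by blast
qed

lemma generates_rot_invariant:
  assumes "generates I x t S" "unitary A" "(z, \<tau>) \<in> S"
  shows "(A *v z, \<tau>) \<in> S"
  using assms by (auto simp: generates_def rot_image unitary_norm)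

text \<open>
  Velocity at \<open>\<epsilon> = s\<close> of the horizontal generating curve \<open>\<epsilon> \<mapsto> (x \<epsilon> exp(\<i> \<theta> \<epsilon>) \<omega>\<^sub>0, t \<epsilon>)\<close>, \<open>\<theta>' = - t' / x\<^sup>2\<close>,
  rotated by \<open>U(n)\<close> so that it passes through \<open>rot_map x t (s, \<omega>)\<close>, that is \<open>\<omega> = exp(\<i> \<theta> s) \<omega>\<^sub>0\<close>.
\<close>

definition hgen_velocity :: "(real \<Rightarrow> real) \<Rightarrow> (real \<Rightarrow> real) \<Rightarrow> real \<times> (complex ^ 'n::finite) \<Rightarrow> 'n heis" where
  "hgen_velocity x t q = (case q of (s, \<omega>) \<Rightarrow>
     (Complex (deriv x s) (x s * (- deriv t s / (x s)\<^sup>2)) *s \<omega>, deriv t s))"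

lemma hgen_velocity:
  assumes "x field_differentiable (at s)" "t field_differentiable (at s)"
    and "(\<theta> has_real_derivative - deriv t s / (x s)\<^sup>2) (at s)"
  shows "((\<lambda>\<epsilon>. (x \<epsilon> *\<^sub>R (cis (\<theta> \<epsilon>) *s \<omega>\<^sub>0), t \<epsilon>)) has_vector_derivative
           hgen_velocity x t (s, cis (\<theta> s) *s \<omega>\<^sub>0)) (at s)"
proof -
  have x: "(x has_vector_derivative deriv x s) (at s)" and t: "(t has_vector_derivative deriv t s) (at s)"
    using assms(1,2) by (simp_all add: field_differentiable_derivI has_real_derivative_iff_has_vector_derivative[symmetric])
  have "((\<lambda>\<epsilon>. exp (\<i> * of_real (\<theta> \<epsilon>))) has_vector_derivative
      of_real (- deriv t s / (x s)\<^sup>2) * (\<i> * exp (\<i> * of_real (\<theta> s)))) (at s)"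
    by (rule field_vector_diff_chain_at[where f = "\<lambda>\<epsilon>. of_real (\<theta> \<epsilon>)", unfolded o_def])
       (rule has_vector_derivative_of_real[OF assms(3), simplified of_real_minus], 
         auto intro!: derivative_eq_intros)
  then have c: "((\<lambda>\<epsilon>. cis (\<theta> \<epsilon>)) has_vector_derivative
      of_real (- deriv t s / (x s)\<^sup>2) * (\<i> * cis (\<theta> s))) (at s)"
    by (simp add: cis_conv_exp)
  have bl: "bounded_linear (\<lambda>c::complex. c *s \<omega>\<^sub>0)"
    by (intro linear_conv_bounded_linear[THEN iffD1] linearI) 
       (simp_all add: vec_eq_iff algebra_simps)
  from has_vector_derivative_scaleR[OF assms(1)[THEN field_differentiable_derivI] c]
  have "((\<lambda>\<epsilon>. (x \<epsilon> *\<^sub>R cis (\<theta> \<epsilon>)) *s \<omega>\<^sub>0) has_vector_derivative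
     (x s *\<^sub>R (of_real (- deriv t s / (x s)\<^sup>2) * (\<i> * cis (\<theta> s))) + deriv x s *\<^sub>R cis (\<theta> s)) *s \<omega>\<^sub>0) (at s)"
    by (rule bounded_linear.has_vector_derivative[OF bl])
  moreover have "(x s *\<^sub>R (of_real (- deriv t s / (x s)\<^sup>2) * (\<i> * cis (\<theta> s))) + deriv x s *\<^sub>R cis (\<theta> s)) *s \<omega>\<^sub>0
     = Complex (deriv x s) (x s * (- deriv t s / (x s)\<^sup>2)) *s (cis (\<theta> s) *s \<omega>\<^sub>0)"
    by (simp add: vec_eq_iff scaleR_conv_of_real Complex_eq algebra_simps)
  moreover have "(x \<epsilon> *\<^sub>R cis (\<theta> \<epsilon>)) *s \<omega>\<^sub>0 = x \<epsilon> *\<^sub>R (cis (\<theta> \<epsilon>) *s \<omega>\<^sub>0)" for \<epsilon>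
    by (simp add: vec_eq_iff)
  ultimately show ?thesis
    using t by (simp add: hgen_velocity_def has_vector_derivative_Pair)
qed

lemma contact_form_hgen_velocity:
  assumes "x s \<noteq> 0" "norm \<omega> = 1"
  shows "contact_form (rot_map x t (s, \<omega>)) (hgen_velocity x t (s, \<omega>)) = 0"
proof -
  have one: "(\<Sum>j\<in>UNIV. (Re (\<omega> $ j))\<^sup>2 + (Im (\<omega> $ j))\<^sup>2) = 1"
    using assms(2) by (simp add: norm_vec_def L2_set_def cmod_power2)
  have "(\<Sum>j\<in>UNIV. Re (fst (rot_map x t (s, \<omega>)) $ j) * Im (fst (hgen_velocity x t (s, \<omega>)) $ j)
         - Im (fst (rot_map x t (s, \<omega>)) $ j) * Re (fst (hgen_velocity x t (s, \<omega>)) $ j))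
     = (\<Sum>j\<in>UNIV. - deriv t s * ((Re (\<omega> $ j))\<^sup>2 + (Im (\<omega> $ j))\<^sup>2))"
    using assms(1) by (intro sum.cong) (auto simp: rot_map_def hgen_velocity_def field_simps power2_eq_square)
  also have "\<dots> = - deriv t s"
    by (simp only: sum_distrib_left[symmetric] one mult_1_right)
  finally show ?thesis
    by (simp add: contact_form_def hgen_velocity_def)
qed

definition horizontal_arclength :: "real set \<Rightarrow> (real \<Rightarrow> real) \<Rightarrow> (real \<Rightarrow> real) \<Rightarrow> bool" where
  "horizontal_arclength I x t \<longleftrightarrow> (\<forall>s\<in>I. (deriv x s)\<^sup>2 + (deriv t s)\<^sup>2 / (x s)\<^sup>2 = 1)"

lemma levi_hgen_velocity:
  assumes "x s \<noteq> 0" "norm \<omega> = 1"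
  shows "levi (hgen_velocity x t (s, \<omega>)) (hgen_velocity x t (s, \<omega>)) = (deriv x s)\<^sup>2 + (deriv t s)\<^sup>2 / (x s)\<^sup>2"
proof -
  have n: "norm (c *s \<omega>) = norm c * norm \<omega>" for c
    by (simp add: norm_vec_def L2_set_def norm_mult power_mult_distrib sum_distrib_left[symmetric] real_sqrt_mult)
  show ?thesis
    using assms by (simp add: levi_def hgen_velocity_def power2_norm_eq_inner[symmetric] n cmod_power2)
       (simp add: power_divide power2_eq_square)
qed


section \<open>Invariants\<close>

definition e_n :: "real set \<Rightarrow> (real \<Rightarrow> real) \<Rightarrow> (real \<Rightarrow> real) \<Rightarrow> real \<times> (complex ^ 'n::finite) \<Rightarrow> 'n heis" where
  "e_n I x t q = (THE v. v \<in> contact_tangent (rot_dom I) (rot_map x t) q \<and> levi v v = 1 \<and>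
     (\<forall>u \<in> xi' (rot_dom I) (rot_map x t) q. levi u v = 0) \<and> levi v (hgen_velocity x t q) > 0)"

definition e_2n :: "real set \<Rightarrow> (real \<Rightarrow> real) \<Rightarrow> (real \<Rightarrow> real) \<Rightarrow> real \<times> (complex ^ 'n::finite) \<Rightarrow> 'n heis" where
  "e_2n I x t q = J_op (rot_map x t q) (e_n I x t q)"

definition inv_alpha :: "real set \<Rightarrow> (real \<Rightarrow> real) \<Rightarrow> (real \<Rightarrow> real) \<Rightarrow> real \<times> (complex ^ 'n::finite) \<Rightarrow> real" where
  "inv_alpha I x t q = (THE a. a *\<^sub>R e_2n I x t q + T_field \<in> tangent_sp (rot_dom I) (rot_map x t) q)"

definition inv_l :: "real set \<Rightarrow> (real \<Rightarrow> real) \<Rightarrow> (real \<Rightarrow> real) \<Rightarrow> real \<times> (complex ^ 'n::finite) \<Rightarrow> real" where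
  "inv_l I x t q = (THE l. has_cov_deriv (rot_dom I) (rot_map x t) q (e_n I x t q) (e_2n I x t)
                             (- (l *\<^sub>R e_n I x t q)))"

definition inv_k :: "real set \<Rightarrow> (real \<Rightarrow> real) \<Rightarrow> (real \<Rightarrow> real) \<Rightarrow> real \<times> (complex ^ 'n::finite) \<Rightarrow> real" where
  "inv_k I x t q =
     (if CARD('n) = 1
      then (let s = fst q in - deriv t s / (x s * sqrt ((x s * deriv x s)\<^sup>2 + (deriv t s)\<^sup>2)))
      else (THE k. \<forall>v \<in> xi' (rot_dom I) (rot_map x t) q.
              \<exists>D. has_cov_deriv (rot_dom I) (rot_map x t) q v (e_2n I x t) D \<and>
                  - D + inv_alpha I x t q *\<^sub>R J_op (rot_map x t q) v = k *\<^sub>R v))"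

definition p_mean_curvature :: "real set \<Rightarrow> (real \<Rightarrow> real) \<Rightarrow> (real \<Rightarrow> real) \<Rightarrow> real \<times> (complex ^ 'n::finite) \<Rightarrow> real" where
  "p_mean_curvature I x t q = inv_l I x t q + (2 * real CARD('n) - 2) * inv_k I x t q"

definition energy :: "real \<Rightarrow> real set \<Rightarrow> (real \<Rightarrow> real) \<Rightarrow> (real \<Rightarrow> real) \<Rightarrow> real \<times> (complex ^ 'n::finite) \<Rightarrow> real" where
  "energy c I x t q = (c / (2 * real CARD('n)) - inv_k I x t q) * x (fst q) ^ (2 * CARD('n))"

definition const_pmc :: "real \<Rightarrow> real set \<Rightarrow> (real \<Rightarrow> real) \<Rightarrow> (real \<Rightarrow> real) \<Rightarrow> 'n::finite heis set \<Rightarrow> bool" where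
  "const_pmc c I x t S \<longleftrightarrow>
     generates I x t S \<and> (\<forall>q \<in> rot_dom I :: (real \<times> (complex ^ 'n)) set. p_mean_curvature I x t q = c)"

definition const_pmc_energy ::
  "real \<Rightarrow> real \<Rightarrow> real set \<Rightarrow> (real \<Rightarrow> real) \<Rightarrow> (real \<Rightarrow> real) \<Rightarrow> 'n::finite heis set \<Rightarrow> bool" where
  "const_pmc_energy c E I x t S \<longleftrightarrow>
     const_pmc c I x t S \<and> (\<forall>q \<in> rot_dom I :: (real \<times> (complex ^ 'n)) set. energy c I x t q = E)"


section \<open>Reflective hypersurfaces\<close>

text \<open>
  \<open>Sp\<close> and \<open>Sm\<close> are the parts \<open>\<Sigma>\<^sup>+\<close> and \<open>\<Sigma>\<^sup>-\<close> of a reflective hypersurface; each is oriented by a generating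
  curve of its own. The first disjunct is the case \<open>\<alpha> \<noteq> 0\<close>, the second the vertical cylinder, which is its
  own mirror image.
\<close>

definition reflective_pmc :: "real \<Rightarrow> real \<Rightarrow> 'n::finite heis set \<Rightarrow> 'n heis set \<Rightarrow> bool" where
  "reflective_pmc c E Sp Sm \<longleftrightarrow>
     (\<exists>R f Ip xp tp Im xm tm.
        const_pmc_energy c E Ip xp tp Sp \<and>
        (\<forall>q \<in> rot_dom Ip :: (real \<times> (complex ^ 'n)) set. inv_alpha Ip xp tp q \<noteq> 0) \<and>
        const_pmc_energy c E Im xm tm Sm \<and>
        (\<forall>q \<in> rot_dom Im :: (real \<times> (complex ^ 'n)) set. inv_alpha Im xm tm q \<noteq> 0) \<and>
        (\<forall>r\<in>R. 0 \<le> f r) \<and>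
        Sp = {(z, \<tau>). (norm z)\<^sup>2 \<in> R \<and> \<tau> = sqrt (f ((norm z)\<^sup>2))} \<and>
        Sm = {(z, \<tau>). (norm z)\<^sup>2 \<in> R \<and> \<tau> = - sqrt (f ((norm z)\<^sup>2))}) \<or>
     (\<exists>\<rho> I x t. Sp = {(z, \<tau>). norm z = \<rho>} \<and> Sm = Sp \<and> const_pmc_energy c E I x t Sp)"

definition t_shift :: "real \<Rightarrow> 'n::finite heis set \<Rightarrow> 'n heis set" where
  "t_shift h S = (\<lambda>(z, \<tau>). (z, \<tau> + h)) ` S"

text \<open>
  \<open>S'\<close> is the part of \<open>S\<close> lying over the values of \<open>|z|\<close> attained on \<open>S'\<close> (so \<open>S' = S\<close> if these are all the
  values attained on \<open>S\<close>).
\<close>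

definition coincides_over_range :: "'n::finite heis set \<Rightarrow> 'n heis set \<Rightarrow> bool" where
  "coincides_over_range S' S \<longleftrightarrow> S' = {p \<in> S. norm (fst p) \<in> (\<lambda>p'. norm (fst p')) ` S'}"

text \<open>Each part is determined up to translation along the \<open>t\<close>-axis; the two translations are opposite.\<close>

definition same_up_to_translation ::
  "'n::finite heis set \<Rightarrow> 'n heis set \<Rightarrow> 'n heis set \<Rightarrow> 'n heis set \<Rightarrow> bool" where
  "same_up_to_translation Sp' Sm' Sp Sm \<longleftrightarrow>
     (\<exists>h. (coincides_over_range Sp' (t_shift h Sp) \<and> coincides_over_range Sm' (t_shift (- h) Sm)) \<or>
          (coincides_over_range Sp' (t_shift h Sm) \<and> coincides_over_range Sm' (t_shift (- h) Sp)))"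

text \<open>
  The generating curve \<open>x = F\<^sub>E\<close>, \<open>t = - \<integral> (c/(2n) - E/x\<^sup>2\<^sup>n) x\<^sup>2\<close> on \<open>I = G\<^sub>E (a, b)\<close>; \<open>\<sigma> = 1\<close> or \<open>-1\<close> is the sign in
  the definition of the antiderivative \<open>G\<^sub>E\<close>.
\<close>

definition explicit_curve ::
  "nat \<Rightarrow> real \<Rightarrow> real \<Rightarrow> real \<Rightarrow> real \<Rightarrow> real \<Rightarrow> real set \<Rightarrow> (real \<Rightarrow> real) \<Rightarrow> (real \<Rightarrow> real) \<Rightarrow> bool" where
  "explicit_curve n c E a b \<sigma> I x t \<longleftrightarrow>
     (\<exists>G. (\<forall>u\<in>{a<..<b}. (G has_real_derivative
               \<sigma> * (1 / sqrt (1 - u\<^sup>2 * (E / u ^ (2 * n) - c / (2 * real n))\<^sup>2))) (at u)) \<and>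
          inj_on G {a<..<b} \<and> I = G ` {a<..<b} \<and>
          (\<forall>s\<in>I. x s = the_inv_into {a<..<b} G s \<and>
                  (t has_real_derivative - ((c / (2 * real n) - E / x s ^ (2 * n)) * (x s)\<^sup>2)) (at s)))"

end

theory Submission
  imports Defs
begin

text \<open>
  Let \<open>\<zeta> = x' - \<i> t' / x\<close>. This is the velocity of the horizontal generating curve in the frame, divided by
  the position \<open>\<omega>\<close> on the unit sphere. Put \<open>\<nu> = \<zeta> / |\<zeta>| = exp(\<i> \<phi>)\<close>. The contact part of the tangent space
  is the line through \<open>\<zeta> \<omega>\<close> plus the complex complement of \<open>\<omega>\<close>, so the frame coefficients of \<open>e_n\<close> and \<open>e_2n\<close>
  are \<open>\<nu> \<omega>\<close> and \<open>\<i> \<nu> \<omega>\<close>, and all invariants are functions of \<open>\<phi>\<close>: \<open>\<alpha> = cos \<phi> / x\<close>, \<open>k = sin \<phi> / x\<close> and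
  \<open>l = \<phi>' / |\<zeta>| + sin \<phi> / x\<close> (\<open>inv_alpha_eq\<close>, \<open>inv_k_eq\<close>, \<open>inv_l_eq\<close>).

  Hence energy \<open>E\<close> means \<open>sin \<phi> = \<psi> x\<close> with \<open>\<psi> u = u (\<lambda> - E / u^(2n))\<close> and \<open>\<lambda> = c / (2n)\<close> (\<open>energy_iff\<close>).
  Since \<open>sin \<phi> \<le> 1\<close>, the energy is at least \<open>\<lambda> x^(2n) - x^(2n-1)\<close>. Bernoulli's inequality gives the minimum of
  this expression, which is attained at \<open>\<rho> = (2n-1) / c\<close> (\<open>profile_min\<close>). On the cylinder of radius \<open>\<rho>\<close>, oriented
  so that \<open>sin \<phi> = 1\<close>, both the curvature \<open>c\<close> and this energy are attained (\<open>cylinder_curve\<close>).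

  Suppose that \<open>E\<close> exceeds the minimum. Then \<open>\<psi>\<^sup>2 < 1\<close> holds exactly on a bounded interval \<open>U\<close>, because \<open>\<psi>\<close> is
  increasing for \<open>E \<ge> 0\<close>, and positive and convex for \<open>E \<le> 0\<close>. Where \<open>\<alpha> \<noteq> 0\<close>, a curve of energy \<open>E\<close> lies over
  \<open>U\<close> and satisfies \<open>dt/dx = \<plusminus> height_slope x\<close>, \<open>height_slope u = - u \<psi> u / sqrt (1 - (\<psi> u)\<^sup>2)\<close>; so it is the graph
  of plus or minus a primitive of \<open>height_slope\<close>, up to a constant (\<open>level_curve_is_graph\<close>). This gives uniqueness.
  Conversely, \<open>\<psi>\<close> solves \<open>\<psi>' + (2n-1) \<psi> / u = c\<close>, which says that the curve with \<open>sin \<phi> = \<psi> x\<close> has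
  curvature \<open>c\<close> (\<open>solution_curve\<close>).

  For a reflective hypersurface the height has to be of the form \<open>sqrt f\<close>, hence nonnegative, so a primitive of
  \<open>height_slope\<close> must be bounded below although \<open>height_slope\<close> may blow up at the ends of \<open>U\<close>. Where \<open>\<psi>'\<close> has a
  positive lower bound, it is dominated by a multiple of the derivative of the bounded function \<open>arcsin \<circ> \<psi>\<close>. This
  covers all of \<open>U\<close> if \<open>E \<ge> 0\<close>, and the part right of \<open>\<rho>\<close> if \<open>E < 0\<close>; in the latter case the primitive decreases
  up to \<open>\<rho>\<close>, since \<open>\<psi> > 0\<close> (\<open>height_bounded_below\<close>).
\<close>

section \<open>Complex scalars and horizontal vectors\<close>

lemma smult_Re_Im: "c *s v = Re c *\<^sub>R v + Im c *\<^sub>R (\<i> *s v)" for v :: "complex ^ 'n"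
  by (simp add: vec_eq_iff complex_eq_iff)

lemma inner_smult_adjoint: "inner (c *s v) w = inner v (cnj c *s w)" for v w :: "complex ^ 'n::finite"
  unfolding inner_vec_def by (rule sum.cong) (simp_all add: inner_complex_def algebra_simps)

lemma inner_smult_unit:
  fixes \<omega> :: "complex ^ 'n::finite"
  assumes "norm \<omega> = 1"
  shows "inner (c *s \<omega>) (d *s \<omega>) = inner c d"
proof -
  have one: "inner \<omega> \<omega> = 1"
    using assms by (simp add: dot_square_norm)
  have zero: "inner \<omega> (\<i> *s \<omega>) = 0"
    by (simp add: inner_vec_def inner_complex_def)
  have "inner (c *s \<omega>) (d *s \<omega>) = inner \<omega> ((cnj c * d) *s \<omega>)"
    by (simp add: inner_smult_adjoint)
  also have "\<dots> = Re (cnj c * d)"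
    unfolding smult_Re_Im[of "cnj c * d"] inner_add_right inner_scaleR_right one zero by simp
  finally show ?thesis
    by (simp add: inner_complex_def)
qed

lemma norm_smult: "norm (c *s v) = norm c * norm v" for v :: "complex ^ 'n::finite"
  by (simp add: norm_vec_def L2_set_def norm_mult power_mult_distrib sum_distrib_left[symmetric] real_sqrt_mult)

lemma bounded_bilinear_smult: "bounded_bilinear (\<lambda>c (v :: complex ^ 'n::finite). c *s v)"
proof
  show "\<exists>K. \<forall>c (v :: complex ^ 'n). norm (c *s v) \<le> norm c * norm v * K"
    by (intro exI[of _ 1]) (simp add: norm_smult)
qed (simp_all add: vec_eq_iff algebra_simps)

text \<open>
  The orthogonal complement of the complex line through \<open>\<omega>\<close>; for a unit vector it is the space of frame
  coefficients of \<open>xi'\<close> (see \<open>xi'_eq\<close>).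
\<close>

definition complex_perp :: "complex ^ 'n::finite \<Rightarrow> (complex ^ 'n) set" where
  "complex_perp \<omega> = {\<eta>. inner \<eta> \<omega> = 0 \<and> inner \<eta> (\<i> *s \<omega>) = 0}"

lemma complex_perp_inner: "\<eta> \<in> complex_perp \<omega> \<Longrightarrow> inner \<eta> (c *s \<omega>) = 0"
  by (simp add: complex_perp_def smult_Re_Im[of c] inner_add_right)

lemma complex_perp_smult: "\<eta> \<in> complex_perp \<omega> \<Longrightarrow> c *s \<eta> \<in> complex_perp \<omega>"
  using complex_perp_inner[of \<eta> \<omega> "cnj c"] complex_perp_inner[of \<eta> \<omega> "cnj c * \<i>"]
  by (simp add: complex_perp_def inner_smult_adjoint)

lemma zero_complex_perp [simp]: "0 \<in> complex_perp \<omega>"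
  by (simp add: complex_perp_def)

text \<open>
  Needed for the uniqueness of the eigenvalue \<open>k\<close>: real dimension \<open>2 n > 2\<close> leaves room beside \<open>\<omega>\<close> and \<open>\<i> \<omega>\<close>.
\<close>

lemma complex_perp_nontrivial:
  fixes \<omega> :: "complex ^ 'n::finite"
  assumes "CARD('n) \<noteq> 1"
  obtains \<eta> where "\<eta> \<in> complex_perp \<omega>" "\<eta> \<noteq> 0"
proof -
  have "dim {\<omega>, \<i> *s \<omega>} \<le> card {\<omega>, \<i> *s \<omega>}"
    by (rule dim_le_card') simp
  also have "\<dots> \<le> 2"
    by (simp add: card_insert_if)
  also have "2 < DIM(complex ^ 'n)"
  proof -
    have "CARD('n) \<noteq> 0" by simp
    then have "CARD('n) \<ge> 2" using assms by linarith
    then show ?thesis by simp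
  qed
  finally have "span {\<omega>, \<i> *s \<omega>} \<noteq> UNIV"
    by (metis dim_UNIV dim_span less_irrefl)
  then have "span {\<omega>, \<i> *s \<omega>} \<subset> span UNIV"
    by auto
  from orthogonal_to_subspace_exists_gen[OF this] obtain \<eta>
    where "\<eta> \<noteq> 0" "\<And>y. y \<in> span {\<omega>, \<i> *s \<omega>} \<Longrightarrow> orthogonal \<eta> y"
    by metis
  then show ?thesis
    using that[of \<eta>] by (auto simp: complex_perp_def orthogonal_def span_base)
qed

lemma contact_form_inner: "contact_form p v = snd v + inner (\<i> *s fst p) (fst v)"
  by (simp add: contact_form_def inner_vec_def inner_complex_def algebra_simps)

lemma snd_horiz_inner: "snd (horiz p w) = - inner (\<i> *s fst p) w"
  using contact_form_horiz[of p w] by (simp add: contact_form_inner)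

lemma scaleR_horiz: "r *\<^sub>R horiz p w = horiz p (r *\<^sub>R w)"
  by (simp add: prod_eq_iff snd_horiz_inner)

lemma add_horiz: "horiz p v + horiz p w = horiz p (v + w)"
  by (simp add: prod_eq_iff snd_horiz_inner inner_add_right)

lemma uminus_horiz: "- horiz p w = horiz p (- w)"
  by (simp add: prod_eq_iff snd_horiz_inner)

lemma horiz_inject: "horiz p v = horiz p w \<longleftrightarrow> v = w"
  by (metis fst_horiz)

lemma has_vector_derivative_eventually_eq:
  assumes "(f has_vector_derivative d) (at a)" "\<forall>\<^sub>F r in nhds a. f r = g r"
  shows "(g has_vector_derivative d) (at a)"
  using assms has_derivative_transform_eventually[of f "\<lambda>r. r *\<^sub>R d" a UNIV g] eventually_nhds_x_imp_x[OF assms(2)]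
  by (simp add: has_vector_derivative_def eventually_at_filter eventually_mono)

section \<open>Tangent spaces of rotationally symmetric hypersurfaces\<close>

text \<open>
  These are the conditions of \<open>generates\<close> without the surface, and hence without the dimension \<open>n\<close>.
\<close>

locale generating_curve =
  fixes I :: "real set" and x t :: "real \<Rightarrow> real"
  assumes open_I: "open I" 
    and C2_x: "C2_on I x" and C2_t: "C2_on I t"
    and x_pos: "\<And>s. s \<in> I \<Longrightarrow> x s > 0"
    and regular: "\<And>s. s \<in> I \<Longrightarrow> deriv x s \<noteq> 0 \<or> deriv t s \<noteq> 0"
begin

text \<open>
  \<open>\<zeta> \<omega>\<close> gives the frame coefficients of \<open>hgen_velocity\<close>, and \<open>\<nu> = exp(\<i> \<phi>)\<close>, where \<open>\<phi>\<close> is the angle between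
  the horizontal generating curve and the radial direction.
\<close>

definition \<zeta> :: "real \<Rightarrow> complex" where
  "\<zeta> s = Complex (deriv x s) (- deriv t s / x s)"

definition \<nu> :: "real \<Rightarrow> complex" where
  "\<nu> s = sgn (\<zeta> s)"

lemma \<zeta>_nz: "s \<in> I \<Longrightarrow> \<zeta> s \<noteq> 0"
  using x_pos[of s] regular[of s] by (auto simp: \<zeta>_def complex_eq_iff)

lemma norm_\<nu>: "s \<in> I \<Longrightarrow> norm (\<nu> s) = 1"
  by (simp add: \<nu>_def norm_sgn \<zeta>_nz)

lemma deriv_x: "s \<in> I \<Longrightarrow> (x has_real_derivative deriv x s) (at s)"
  using C2_x by (simp add: C2_on_def field_differentiable_derivI)

lemma deriv_t: "s \<in> I \<Longrightarrow> (t has_real_derivative deriv t s) (at s)"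
  using C2_t by (simp add: C2_on_def field_differentiable_derivI)

text \<open>
  The sphere constraint \<open>|\<omega>|\<^sup>2 = 1\<close>, differentiated along the curve, forces the spherical part of the velocity
  to be orthogonal to \<open>\<omega>\<close>.
\<close>

lemma curve_through_velocity:
  fixes \<omega> :: "complex ^ 'n::finite"
  assumes "s \<in> I" "norm \<omega> = 1"
    and g: "curve_through (rot_dom I) (rot_map x t) (s, \<omega>) v g"
  obtains a \<eta> where "((\<lambda>\<epsilon>. fst (g \<epsilon>)) has_real_derivative a) (at 0)"
    "((\<lambda>\<epsilon>. snd (g \<epsilon>)) has_vector_derivative \<eta>) (at 0)" "inner \<omega> \<eta> = 0"
    "v = ((a * deriv x s) *\<^sub>R \<omega> + x s *\<^sub>R \<eta>, a * deriv t s)"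
proof -
  have g0: "g 0 = (s, \<omega>)" and ev: "\<forall>\<^sub>F \<epsilon> in nhds 0. g \<epsilon> \<in> rot_dom I"
    and dif: "g differentiable (at 0)"
    and v: "((\<lambda>\<epsilon>. rot_map x t (g \<epsilon>)) has_vector_derivative v) (at 0)"
    using g by (auto simp: curve_through_def)
  from dif obtain d where d: "(g has_vector_derivative d) (at 0)"
    by (metis vector_derivative_works)
  have d1: "((\<lambda>\<epsilon>. fst (g \<epsilon>)) has_real_derivative fst d) (at 0)"
    using bounded_linear.has_vector_derivative[OF bounded_linear_fst d] 
    by (simp add: has_real_derivative_iff_has_vector_derivative)
  have d2: "((\<lambda>\<epsilon>. snd (g \<epsilon>)) has_vector_derivative snd d) (at 0)"
    by (rule bounded_linear.has_vector_derivative[OF bounded_linear_snd d])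
  have "((\<lambda>\<epsilon>. inner (snd (g \<epsilon>)) (snd (g \<epsilon>))) has_vector_derivative
      (inner (snd (g 0)) (snd d) + inner (snd d) (snd (g 0)))) (at 0)"
    by (rule bounded_bilinear.has_vector_derivative[OF bounded_bilinear_inner d2 d2])
  moreover have "\<forall>\<^sub>F \<epsilon> in nhds 0. inner (snd (g \<epsilon>)) (snd (g \<epsilon>)) = 1"
    using ev by eventually_elim (auto simp: rot_dom_def dot_square_norm)
  ultimately have "((\<lambda>\<epsilon>. 1) has_vector_derivative
      (inner (snd (g 0)) (snd d) + inner (snd d) (snd (g 0)))) (at (0::real))"
    by (rule has_vector_derivative_eventually_eq)
  from vector_derivative_unique_at[OF this has_vector_derivative_const]
  have orth: "inner \<omega> (snd d) = 0"
    by (simp add: g0 inner_commute)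
  have fx: "((\<lambda>\<epsilon>. x (fst (g \<epsilon>))) has_real_derivative deriv x s * fst d) (at 0)"
    using DERIV_chain2[OF _ d1, of x] deriv_x[OF assms(1)] g0 by simp
  have ft: "((\<lambda>\<epsilon>. t (fst (g \<epsilon>))) has_real_derivative deriv t s * fst d) (at 0)"
    using DERIV_chain2[OF _ d1, of t] deriv_t[OF assms(1)] g0 by simp
  have "((\<lambda>\<epsilon>. rot_map x t (g \<epsilon>)) has_vector_derivative
     (x (fst (g 0)) *\<^sub>R snd d + (deriv x s * fst d) *\<^sub>R snd (g 0), deriv t s * fst d)) (at 0)"
    unfolding rot_map_def using ft
    by (intro has_vector_derivative_Pair has_vector_derivative_scaleR fx d2)
       (simp add: has_real_derivative_iff_has_vector_derivative)
  from vector_derivative_unique_at[OF v this]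
  have "v = ((fst d * deriv x s) *\<^sub>R \<omega> + x s *\<^sub>R snd d, fst d * deriv t s)"
    by (simp add: g0 mult.commute)
  with d1 d2 orth show ?thesis by (rule that)
qed

lemma curve_through_exists:
  fixes \<omega> :: "complex ^ 'n::finite"
  assumes "s \<in> I" "norm \<omega> = 1" "inner \<omega> \<eta> = 0"
  obtains g where "curve_through (rot_dom I) (rot_map x t) (s, \<omega>)
    ((a * deriv x s) *\<^sub>R \<omega> + x s *\<^sub>R \<eta>, a * deriv t s) g"
proof -
  define r where "r = norm \<eta>"
  (* A great circle with initial velocity \<eta>; if \<eta> = 0 then r = 0 and the circle is constant. *)
  define g where "g \<epsilon> = (s + \<epsilon> * a, cos (r * \<epsilon>) *\<^sub>R \<omega> + sin (r * \<epsilon>) *\<^sub>R sgn \<eta>)" for \<epsilon>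
  have g0: "g 0 = (s, \<omega>)" by (simp add: g_def)
  have "norm (snd (g \<epsilon>)) = 1" for \<epsilon>
  proof -
    have "(norm (snd (g \<epsilon>)))\<^sup>2 = (cos (r * \<epsilon>))\<^sup>2 + (sin (r * \<epsilon>) * norm (sgn \<eta>))\<^sup>2"
      using assms(2,3)
      by (simp add: g_def norm_add_Pythagorean orthogonal_def sgn_div_norm power_mult_distrib)
    also have "\<dots> = 1"
      by (cases "\<eta> = 0") (auto simp: r_def norm_sgn)
    finally show ?thesis
      using norm_ge_zero[of "snd (g \<epsilon>)"] by (simp add: power2_eq_1_iff)
  qed
  moreover have "\<forall>\<^sub>F \<epsilon> in nhds 0. s + \<epsilon> * a \<in> I"
  proof -
    have "((\<lambda>\<epsilon>. s + \<epsilon> * a) \<longlongrightarrow> s + 0 * a) (nhds 0)"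
      by (intro tendsto_intros filterlim_ident)
    then show ?thesis
      using topological_tendstoD[OF _ open_I] assms(1) by fastforce
  qed
  ultimately have ev: "\<forall>\<^sub>F \<epsilon> in nhds 0. g \<epsilon> \<in> rot_dom I"
    by (auto simp: rot_dom_def g_def elim: eventually_mono)
  have "r *\<^sub>R sgn \<eta> = \<eta>"
    by (cases "\<eta> = 0") (simp_all add: r_def sgn_div_norm)
  moreover have c: "((\<lambda>\<epsilon>. cos (r * \<epsilon>)) has_real_derivative 0) (at 0)"
    by (auto intro!: derivative_eq_intros)
  moreover have sn: "((\<lambda>\<epsilon>. sin (r * \<epsilon>)) has_real_derivative r) (at 0)"
    by (auto intro!: derivative_eq_intros)
  have "((\<lambda>\<epsilon>. cos (r * \<epsilon>) *\<^sub>R \<omega> + sin (r * \<epsilon>) *\<^sub>R sgn \<eta>) has_vector_derivative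
      cos (r * 0) *\<^sub>R 0 + 0 *\<^sub>R \<omega> + (sin (r * 0) *\<^sub>R 0 + r *\<^sub>R sgn \<eta>)) (at 0)"
    by (intro has_vector_derivative_add has_vector_derivative_scaleR has_vector_derivative_const c sn)
  ultimately have d2: "((\<lambda>\<epsilon>. snd (g \<epsilon>)) has_vector_derivative \<eta>) (at 0)"
    by (simp add: g_def)
  have d1: "((\<lambda>\<epsilon>. fst (g \<epsilon>)) has_real_derivative a) (at 0)"
    unfolding g_def by (auto intro!: derivative_eq_intros)
  have d: "g differentiable (at 0)"
    using has_vector_derivative_Pair[OF d1[unfolded has_real_derivative_iff_has_vector_derivative] d2]
    by (auto intro: differentiableI_vector)
  have fx: "((\<lambda>\<epsilon>. x (fst (g \<epsilon>))) has_real_derivative deriv x s * a) (at 0)"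
    using DERIV_chain2[OF _ d1, of x] deriv_x[OF assms(1)] g0 by simp
  have ft: "((\<lambda>\<epsilon>. t (fst (g \<epsilon>))) has_real_derivative deriv t s * a) (at 0)"
    using DERIV_chain2[OF _ d1, of t] deriv_t[OF assms(1)] g0 by simp
  have "((\<lambda>\<epsilon>. rot_map x t (g \<epsilon>)) has_vector_derivative
     (x (fst (g 0)) *\<^sub>R \<eta> + (deriv x s * a) *\<^sub>R snd (g 0), deriv t s * a)) (at 0)"
    unfolding rot_map_def using ft
    by (intro has_vector_derivative_Pair has_vector_derivative_scaleR fx d2)
       (simp add: has_real_derivative_iff_has_vector_derivative)
  then show ?thesis
    using ev g0 d by (intro that[of g]) (simp add: curve_through_def add.commute mult.commute)
qed

lemma tangent_sp_eq:
  fixes \<omega> :: "complex ^ 'n::finite"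
  assumes "s \<in> I" "norm \<omega> = 1"
  shows "tangent_sp (rot_dom I) (rot_map x t) (s, \<omega>) =
    {((a * deriv x s) *\<^sub>R \<omega> + x s *\<^sub>R \<eta>, a * deriv t s) | a \<eta>. inner \<omega> \<eta> = 0}"
proof (intro equalityI subsetI)
  fix v assume "v \<in> tangent_sp (rot_dom I) (rot_map x t) (s, \<omega>)"
  then obtain g where "curve_through (rot_dom I) (rot_map x t) (s, \<omega>) v g"
    by (auto simp: tangent_sp_def)
  from curve_through_velocity[OF assms this]
  show "v \<in> {((a * deriv x s) *\<^sub>R \<omega> + x s *\<^sub>R \<eta>, a * deriv t s) | a \<eta>. inner \<omega> \<eta> = 0}"
    by blast
next
  fix v assume "v \<in> {((a * deriv x s) *\<^sub>R \<omega> + x s *\<^sub>R \<eta>, a * deriv t s) | a \<eta>. inner \<omega> \<eta> = 0}"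
  then obtain a \<eta> where "v = ((a * deriv x s) *\<^sub>R \<omega> + x s *\<^sub>R \<eta>, a * deriv t s)" "inner \<omega> \<eta> = 0"
    by blast
  then show "v \<in> tangent_sp (rot_dom I) (rot_map x t) (s, \<omega>)"
    using curve_through_exists[OF assms, of \<eta> a] by (auto simp: tangent_sp_def)
qed

lemma snd_horiz_rot_map:
  fixes \<omega> :: "complex ^ 'n::finite"
  assumes "norm \<omega> = 1" "\<eta> \<in> complex_perp \<omega>"
  shows "snd (horiz (rot_map x t (s, \<omega>)) (c *s \<omega> + \<eta>)) = - (x s * Im c)"
proof -
  have "\<i> *s (x s *\<^sub>R \<omega>) = (\<i> * x s) *s \<omega>"
    unfolding vec_eq_iff vector_scaleR_component vector_smult_component by (simp add: scaleR_conv_of_real)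
  then have "inner (\<i> *s (x s *\<^sub>R \<omega>)) (c *s \<omega> + \<eta>) = inner ((\<i> * x s) *s \<omega>) (c *s \<omega>) + inner \<eta> ((\<i> * x s) *s \<omega>)"
    by (simp only: inner_add_right inner_commute[of _ \<eta>])
  also have "\<dots> = x s * Im c"
    by (simp only: inner_smult_unit[OF assms(1)] complex_perp_inner[OF assms(2)]) 
       (simp add: inner_complex_def)
  finally show ?thesis
    by (simp add: snd_horiz_inner rot_map_def)
qed

text \<open>
  The decomposition of a horizontal tangent vector into its \<open>s\<close>-part and its spherical part. The \<open>t\<close>-component
  \<open>a t'\<close> is compensated by a rotation of \<open>\<omega>\<close> along \<open>\<i> \<omega>\<close> with speed \<open>- a t' / x\<^sup>2\<close>.
\<close>

lemma horiz_frame: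
  fixes \<omega> :: "complex ^ 'n::finite"
  assumes "s \<in> I" "norm \<omega> = 1" "\<eta> \<in> complex_perp \<omega>"
  shows "horiz (rot_map x t (s, \<omega>)) ((a *\<^sub>R \<zeta> s) *s \<omega> + \<eta>) = 
    ((a * deriv x s) *\<^sub>R \<omega> + x s *\<^sub>R ((- a * deriv t s / (x s)\<^sup>2) *\<^sub>R (\<i> *s \<omega>) + \<eta> /\<^sub>R x s), a * deriv t s)"
proof -
  have "fst (horiz (rot_map x t (s, \<omega>)) ((a *\<^sub>R \<zeta> s) *s \<omega> + \<eta>)) 
    = (a * deriv x s) *\<^sub>R \<omega> + x s *\<^sub>R ((- a * deriv t s / (x s)\<^sup>2) *\<^sub>R (\<i> *s \<omega>) + \<eta> /\<^sub>R x s)"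
    using x_pos[OF assms(1)]
    by (simp add: smult_Re_Im[of "a *\<^sub>R \<zeta> s"]) (simp add: \<zeta>_def power2_eq_square scaleR_diff_right)
  then show ?thesis
    using snd_horiz_rot_map[OF assms(2,3), of s "a *\<^sub>R \<zeta> s"] x_pos[OF assms(1)]
    by (simp add: prod_eq_iff \<zeta>_def)
qed

lemma contact_tangent_eq:
  fixes \<omega> :: "complex ^ 'n::finite"
  assumes s: "s \<in> I" and \<omega>: "norm \<omega> = 1"
  shows "contact_tangent (rot_dom I) (rot_map x t) (s, \<omega>) =
    {horiz (rot_map x t (s, \<omega>)) ((a *\<^sub>R \<zeta> s) *s \<omega> + \<eta>) | a \<eta>. \<eta> \<in> complex_perp \<omega>}"
proof (intro equalityI subsetI)
  fix v assume "v \<in> contact_tangent (rot_dom I) (rot_map x t) (s, \<omega>)"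
  then obtain a \<eta> where v: "v = ((a * deriv x s) *\<^sub>R \<omega> + x s *\<^sub>R \<eta>, a * deriv t s)" and \<eta>: "inner \<omega> \<eta> = 0"
    and c: "contact_form (rot_map x t (s, \<omega>)) v = 0"
    unfolding contact_tangent_def tangent_sp_eq[OF assms] by blast
  define \<eta>' where "\<eta>' = x s *\<^sub>R \<eta> + (a * deriv t s / x s) *\<^sub>R (\<i> *s \<omega>)"
  have u: "inner \<omega> \<omega> = 1" "inner (\<i> *s \<omega>) (\<i> *s \<omega>) = 1" "inner (\<i> *s \<omega>) \<omega> = 0"
    using inner_smult_unit[OF \<omega>, of 1 1] inner_smult_unit[OF \<omega>, of \<i> \<i>] inner_smult_unit[OF \<omega>, of \<i> 1]
    by (simp_all add: inner_complex_def)
  have i: "\<i> *s (r *\<^sub>R w) = r *\<^sub>R (\<i> *s w)" for r and w :: "complex ^ 'n"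
    by (simp add: vec_eq_iff)
  have "a * deriv t s + x s * (x s * inner (\<i> *s \<omega>) \<eta>) = 0"
    using c by (simp add: contact_form_inner rot_map_def v i inner_add_right u)
  then have "inner (\<i> *s \<omega>) \<eta>' = 0"
    using x_pos[OF s] by (simp add: \<eta>'_def inner_add_right u field_simps)
  moreover have "inner \<omega> \<eta>' = 0"
    using \<eta> u by (simp add: \<eta>'_def inner_add_right inner_commute)
  ultimately have \<eta>': "\<eta>' \<in> complex_perp \<omega>"
    by (simp add: complex_perp_def inner_commute)
  have "\<eta> = (- a * deriv t s / (x s)\<^sup>2) *\<^sub>R (\<i> *s \<omega>) + \<eta>' /\<^sub>R x s"
    using x_pos[OF s] by (simp add: \<eta>'_def algebra_simps power2_eq_square divide_inverse)
  then have "v = horiz (rot_map x t (s, \<omega>)) ((a *\<^sub>R \<zeta> s) *s \<omega> + \<eta>')"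
    by (simp only: horiz_frame[OF assms \<eta>'] v)
  with \<eta>' show "v \<in> {horiz (rot_map x t (s, \<omega>)) ((a *\<^sub>R \<zeta> s) *s \<omega> + \<eta>) | a \<eta>. \<eta> \<in> complex_perp \<omega>}"
    by blast
next
  fix v assume "v \<in> {horiz (rot_map x t (s, \<omega>)) ((a *\<^sub>R \<zeta> s) *s \<omega> + \<eta>) | a \<eta>. \<eta> \<in> complex_perp \<omega>}"
  then obtain a \<eta> where v: "v = horiz (rot_map x t (s, \<omega>)) ((a *\<^sub>R \<zeta> s) *s \<omega> + \<eta>)" and \<eta>: "\<eta> \<in> complex_perp \<omega>"
    by blast
  have "inner \<omega> ((- a * deriv t s / (x s)\<^sup>2) *\<^sub>R (\<i> *s \<omega>) + \<eta> /\<^sub>R x s) = 0"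
    using \<eta> inner_smult_unit[OF \<omega>, of 1 \<i>]
    by (simp add: complex_perp_def inner_diff_right inner_commute[of \<omega> \<eta>] inner_complex_def)
  then have "v \<in> tangent_sp (rot_dom I) (rot_map x t) (s, \<omega>)"
    unfolding v horiz_frame[OF assms \<eta>] tangent_sp_eq[OF assms] by blast
  then show "v \<in> contact_tangent (rot_dom I) (rot_map x t) (s, \<omega>)"
    by (simp add: contact_tangent_def v contact_form_horiz)
qed

text \<open>
  Multiplication by \<open>\<i>\<close> preserves \<open>complex_perp \<omega>\<close> and turns the real line through \<open>\<zeta> \<omega>\<close> into an orthogonal one,
  so only \<open>complex_perp \<omega>\<close> survives in the intersection.
\<close>

lemma xi'_eq:
  fixes \<omega> :: "complex ^ 'n::finite"
  assumes s: "s \<in> I" and \<omega>: "norm \<omega> = 1"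
  shows "xi' (rot_dom I) (rot_map x t) (s, \<omega>) = horiz (rot_map x t (s, \<omega>)) ` complex_perp \<omega>"
proof (intro equalityI subsetI)
  fix v assume "v \<in> xi' (rot_dom I) (rot_map x t) (s, \<omega>)"
  then obtain a \<eta> b \<eta>' where v: "v = horiz (rot_map x t (s, \<omega>)) ((a *\<^sub>R \<zeta> s) *s \<omega> + \<eta>)" and \<eta>: "\<eta> \<in> complex_perp \<omega>"
    and v': "v = J_op (rot_map x t (s, \<omega>)) (horiz (rot_map x t (s, \<omega>)) ((b *\<^sub>R \<zeta> s) *s \<omega> + \<eta>'))" 
    and \<eta>': "\<eta>' \<in> complex_perp \<omega>"
    unfolding xi'_def contact_tangent_eq[OF assms] by blast
  have "(a *\<^sub>R \<zeta> s) *s \<omega> + \<eta> = \<i> *s ((b *\<^sub>R \<zeta> s) *s \<omega> + \<eta>')"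
    using v v' by (simp add: J_op_def horiz_inject)
  then have eq: "(a *\<^sub>R \<zeta> s) *s \<omega> + \<eta> = (\<i> * (b *\<^sub>R \<zeta> s)) *s \<omega> + \<i> *s \<eta>'"
    by (simp add: vec_eq_iff algebra_simps)
  have "inner ((a *\<^sub>R \<zeta> s) *s \<omega> + \<eta>) (\<zeta> s *s \<omega>) = inner ((\<i> * (b *\<^sub>R \<zeta> s)) *s \<omega> + \<i> *s \<eta>') (\<zeta> s *s \<omega>)"
    by (simp only: eq)
  then have "inner (a *\<^sub>R \<zeta> s) (\<zeta> s) = inner (\<i> * (b *\<^sub>R \<zeta> s)) (\<zeta> s)"
    by (simp only: inner_add_left inner_smult_unit[OF \<omega>] complex_perp_inner[OF \<eta>] 
          complex_perp_inner[OF complex_perp_smult[OF \<eta>']] add_0_right)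
  moreover have "inner (\<i> * (b *\<^sub>R \<zeta> s)) (\<zeta> s) = 0"
    by (simp add: inner_complex_def)
  ultimately have "a * (norm (\<zeta> s))\<^sup>2 = 0"
    by (simp add: dot_square_norm)
  then have "a = 0"
    using \<zeta>_nz[OF s] by simp
  then show "v \<in> horiz (rot_map x t (s, \<omega>)) ` complex_perp \<omega>"
    using v \<eta> by simp
next
  fix v assume "v \<in> horiz (rot_map x t (s, \<omega>)) ` complex_perp \<omega>"
  then obtain \<eta> where v: "v = horiz (rot_map x t (s, \<omega>)) \<eta>" and \<eta>: "\<eta> \<in> complex_perp \<omega>"
    by blast
  have in_ct: "horiz (rot_map x t (s, \<omega>)) \<eta>' \<in> contact_tangent (rot_dom I) (rot_map x t) (s, \<omega>)"
    if "\<eta>' \<in> complex_perp \<omega>" for \<eta>'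
    unfolding contact_tangent_eq[OF assms] using that
    by (intro CollectI exI[of _ 0] exI[of _ \<eta>']) simp
  have "v = J_op (rot_map x t (s, \<omega>)) (horiz (rot_map x t (s, \<omega>)) ((- \<i>) *s \<eta>))"
    by (simp add: v J_op_def)
  then show "v \<in> xi' (rot_dom I) (rot_map x t) (s, \<omega>)"
    unfolding xi'_def v
    using in_ct[OF \<eta>] in_ct[OF complex_perp_smult[OF \<eta>, of "- \<i>"]] v by auto
qed

section \<open>The invariants in terms of the generating curve\<close>

lemma e_n_eq:
  fixes \<omega> :: "complex ^ 'n::finite"
  assumes s: "s \<in> I" and \<omega>: "norm \<omega> = 1"
  shows "e_n I x t (s, \<omega>) = horiz (rot_map x t (s, \<omega>)) (\<nu> s *s \<omega>)"
  unfolding e_n_def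
proof (rule the_equality)
  have hv: "fst (hgen_velocity x t (s, \<omega>)) = \<zeta> s *s \<omega>"
    using x_pos[OF s] by (simp add: hgen_velocity_def \<zeta>_def power2_eq_square)
  have \<nu>: "\<nu> s = (1 / norm (\<zeta> s)) *\<^sub>R \<zeta> s"
    by (simp add: \<nu>_def sgn_div_norm divide_inverse)
  have pos: "inner (\<zeta> s) (\<zeta> s) = (norm (\<zeta> s))\<^sup>2"
    by (simp add: dot_square_norm)
  have "\<nu> s *s \<omega> = ((1 / norm (\<zeta> s)) *\<^sub>R \<zeta> s) *s \<omega> + 0"
    by (simp add: \<nu>)
  then have "horiz (rot_map x t (s, \<omega>)) (\<nu> s *s \<omega>) \<in> contact_tangent (rot_dom I) (rot_map x t) (s, \<omega>)"
    unfolding contact_tangent_eq[OF assms]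
    by (intro CollectI exI[of _ "1 / norm (\<zeta> s)"] exI[of _ 0]) (simp add: \<nu>)
  moreover have "levi (horiz (rot_map x t (s, \<omega>)) (\<nu> s *s \<omega>)) (horiz (rot_map x t (s, \<omega>)) (\<nu> s *s \<omega>)) = 1"
    unfolding levi_def fst_horiz inner_smult_unit[OF \<omega>] using norm_\<nu>[OF s] by (simp add: dot_square_norm)
  moreover have "levi (horiz (rot_map x t (s, \<omega>)) (\<nu> s *s \<omega>)) (hgen_velocity x t (s, \<omega>)) > 0"
    using \<zeta>_nz[OF s] by (simp add: levi_def hv inner_smult_unit[OF \<omega>] \<nu> pos)
  ultimately show "horiz (rot_map x t (s, \<omega>)) (\<nu> s *s \<omega>) \<in> contact_tangent (rot_dom I) (rot_map x t) (s, \<omega>) \<and>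
    levi (horiz (rot_map x t (s, \<omega>)) (\<nu> s *s \<omega>)) (horiz (rot_map x t (s, \<omega>)) (\<nu> s *s \<omega>)) = 1 \<and>
    (\<forall>u\<in>xi' (rot_dom I) (rot_map x t) (s, \<omega>). levi u (horiz (rot_map x t (s, \<omega>)) (\<nu> s *s \<omega>)) = 0) \<and>
    levi (horiz (rot_map x t (s, \<omega>)) (\<nu> s *s \<omega>)) (hgen_velocity x t (s, \<omega>)) > 0"
    by (auto simp: xi'_eq[OF assms] levi_def complex_perp_inner)
  fix v assume v: "v \<in> contact_tangent (rot_dom I) (rot_map x t) (s, \<omega>) \<and> levi v v = 1 \<and>
    (\<forall>u\<in>xi' (rot_dom I) (rot_map x t) (s, \<omega>). levi u v = 0) \<and> 0 < levi v (hgen_velocity x t (s, \<omega>))"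
  then obtain a \<eta> where v_eq: "v = horiz (rot_map x t (s, \<omega>)) ((a *\<^sub>R \<zeta> s) *s \<omega> + \<eta>)" and \<eta>: "\<eta> \<in> complex_perp \<omega>"
    unfolding contact_tangent_eq[OF assms] by blast
  have "inner \<eta> ((a *\<^sub>R \<zeta> s) *s \<omega> + \<eta>) = 0"
    using v \<eta> by (auto simp: xi'_eq[OF assms] levi_def v_eq)
  then have "inner \<eta> \<eta> = 0"
    by (simp only: inner_add_right complex_perp_inner[OF \<eta>] add_0_left)
  then have \<eta>0: "\<eta> = 0"
    by simp
  have "a * (norm (\<zeta> s))\<^sup>2 > 0"
    using v by (simp add: levi_def v_eq hv \<eta>0 inner_smult_unit[OF \<omega>] pos)
  then have "a > 0"
    by (simp add: zero_less_mult_iff)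
  moreover have "(a * norm (\<zeta> s))\<^sup>2 = 1"
    using v by (simp add: levi_def v_eq hv \<eta>0 inner_smult_unit[OF \<omega>] pos power2_eq_square mult_ac)
  ultimately have "a * norm (\<zeta> s) = 1"
    by (metis less_eq_real_def mult_nonneg_nonneg norm_ge_zero not_one_le_zero neg_0_le_iff_le power2_eq_1_iff)
  then have "a = 1 / norm (\<zeta> s)"
    by (metis nonzero_eq_divide_eq mult_zero_right zero_neq_one)
  then show "v = horiz (rot_map x t (s, \<omega>)) (\<nu> s *s \<omega>)"
    by (simp add: v_eq \<eta>0 \<nu>)
qed

lemma e_2n_eq:
  fixes \<omega> :: "complex ^ 'n::finite"
  assumes s: "s \<in> I" and \<omega>: "norm \<omega> = 1"
  shows "e_2n I x t (s, \<omega>) = horiz (rot_map x t (s, \<omega>)) ((\<i> * \<nu> s) *s \<omega>)"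
  by (simp add: e_2n_def J_op_def e_n_eq[OF assms])

lemma inv_alpha_eq:
  fixes \<omega> :: "complex ^ 'n::finite"
  assumes s: "s \<in> I" and \<omega>: "norm \<omega> = 1"
  shows "inv_alpha I x t (s, \<omega>) = deriv x s / (x s * norm (\<zeta> s))"
  unfolding inv_alpha_def
proof (rule the_equality)
  let ?z = "norm (\<zeta> s)"
  have z: "?z > 0" using \<zeta>_nz[OF s] by simp
  have z2: "?z\<^sup>2 = (deriv x s)\<^sup>2 + (deriv t s)\<^sup>2 / (x s)\<^sup>2"
    by (simp add: \<zeta>_def cmod_power2 power_divide)
  have \<nu>: "Re (\<nu> s) = deriv x s / ?z" "Im (\<nu> s) = - deriv t s / (x s * ?z)"
    by (simp_all add: \<nu>_def sgn_div_norm \<zeta>_def divide_inverse mult.commute)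
  have vec: "\<alpha> *\<^sub>R e_2n I x t (s, \<omega>) + T_field =
     ((\<alpha> * deriv t s / (x s * ?z)) *\<^sub>R \<omega> + (\<alpha> * deriv x s / ?z) *\<^sub>R (\<i> *s \<omega>), 1 - \<alpha> * x s * deriv x s / ?z)" for \<alpha>
    using snd_horiz_rot_map[OF \<omega> zero_complex_perp, of s "\<i> * \<nu> s"]
    by (simp add: prod_eq_iff e_2n_eq[OF assms] T_field_def \<nu> smult_Re_Im[of "\<i> * \<nu> s"] scaleR_add_right)
  have o: "inner \<omega> (\<i> *s \<omega>) = 0" and u: "inner \<omega> \<omega> = 1"
    using inner_smult_unit[OF \<omega>, of 1 \<i>] inner_smult_unit[OF \<omega>, of 1 1] by (simp_all add: inner_complex_def)
  let ?\<alpha> = "deriv x s / (x s * ?z)" and ?a = "deriv t s / ((x s)\<^sup>2 * ?z\<^sup>2)"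
  show "?\<alpha> *\<^sub>R e_2n I x t (s, \<omega>) + T_field \<in> tangent_sp (rot_dom I) (rot_map x t) (s, \<omega>)"
    unfolding tangent_sp_eq[OF assms] vec
  proof (intro CollectI exI conjI)
    have 1: "?\<alpha> * deriv t s / (x s * ?z) = ?a * deriv x s"
      by (simp add: power2_eq_square mult_ac)
    have "?z\<^sup>2 - (deriv x s)\<^sup>2 = (deriv t s)\<^sup>2 / (x s)\<^sup>2"
      by (simp add: z2)
    then have "1 - (deriv x s)\<^sup>2 / ?z\<^sup>2 = (deriv t s)\<^sup>2 / (x s)\<^sup>2 / ?z\<^sup>2"
      using z by (metis diff_divide_distrib divide_self less_irrefl power_not_zero)
    then have 2: "1 - ?\<alpha> * x s * deriv x s / ?z = ?a * deriv t s"
      using x_pos[OF s] by (simp add: power2_eq_square mult_ac)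
    have 3: "(?\<alpha> * deriv x s / ?z) *\<^sub>R (\<i> *s \<omega>) = x s *\<^sub>R ((?\<alpha> * deriv x s / (?z * x s)) *\<^sub>R (\<i> *s \<omega>))"
      using x_pos[OF s] by simp
    show "((?\<alpha> * deriv t s / (x s * ?z)) *\<^sub>R \<omega> + (?\<alpha> * deriv x s / ?z) *\<^sub>R (\<i> *s \<omega>), 1 - ?\<alpha> * x s * deriv x s / ?z)
      = ((?a * deriv x s) *\<^sub>R \<omega> + x s *\<^sub>R ((?\<alpha> * deriv x s / (?z * x s)) *\<^sub>R (\<i> *s \<omega>)), ?a * deriv t s)"
      by (simp only: 1 2 3)
    show "inner \<omega> ((?\<alpha> * deriv x s / (?z * x s)) *\<^sub>R (\<i> *s \<omega>)) = 0"
      by (simp add: o)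
  qed
  fix \<alpha> assume "\<alpha> *\<^sub>R e_2n I x t (s, \<omega>) + T_field \<in> tangent_sp (rot_dom I) (rot_map x t) (s, \<omega>)"
  then obtain a \<eta> where 
      1: "(\<alpha> * deriv t s / (x s * ?z)) *\<^sub>R \<omega> + (\<alpha> * deriv x s / ?z) *\<^sub>R (\<i> *s \<omega>) = (a * deriv x s) *\<^sub>R \<omega> + x s *\<^sub>R \<eta>"
    and 2: "1 - \<alpha> * x s * deriv x s / ?z = a * deriv t s" and 3: "inner \<omega> \<eta> = 0"
    unfolding vec tangent_sp_eq[OF assms] by blast
  have "inner \<omega> ((\<alpha> * deriv t s / (x s * ?z)) *\<^sub>R \<omega> + (\<alpha> * deriv x s / ?z) *\<^sub>R (\<i> *s \<omega>)) 
      = inner \<omega> ((a * deriv x s) *\<^sub>R \<omega> + x s *\<^sub>R \<eta>)"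
    by (simp only: 1)
  then have 4: "\<alpha> * deriv t s / (x s * ?z) = a * deriv x s"
    by (simp add: inner_add_right o u 3)
  have "deriv x s = deriv x s * (a * deriv t s + \<alpha> * x s * deriv x s / ?z)"
    using 2 by (simp add: algebra_simps)
  also have "\<dots> = (a * deriv x s) * deriv t s + \<alpha> * x s * (deriv x s)\<^sup>2 / ?z"
    by (simp add: algebra_simps power2_eq_square)
  also have "\<dots> = \<alpha> * x s / ?z * ((deriv x s)\<^sup>2 + (deriv t s)\<^sup>2 / (x s)\<^sup>2)"
    unfolding 4[symmetric] using x_pos[OF s] by (simp add: power2_eq_square distrib_left mult_ac)
  also have "\<dots> = \<alpha> * x s * ?z"
    unfolding z2[symmetric] using z by (simp add: power2_eq_square)
  finally show "\<alpha> = deriv x s / (x s * ?z)"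
    using z x_pos[OF s] by (simp add: field_simps)
qed

lemma \<nu>_differentiable:
  assumes "s \<in> I"
  obtains d where "(\<nu> has_vector_derivative d) (at s)"
proof -
  have "deriv x field_differentiable (at s)" "deriv t field_differentiable (at s)"
    using C2_x C2_t assms by (auto simp: C2_on_def)
  then obtain x2 t2 where x2: "(deriv x has_real_derivative x2) (at s)" 
    and t2: "(deriv t has_real_derivative t2) (at s)"
    by (auto simp: field_differentiable_def)
  define w where "w r = (deriv x r)\<^sup>2 + (deriv t r / x r)\<^sup>2" for r
  have w: "w s > 0"
    using regular[OF assms] x_pos[OF assms] by (auto simp: w_def sum_power2_gt_zero_iff)
  have norm: "norm (\<zeta> r) = sqrt (w r)" for r
    by (simp add: \<zeta>_def w_def norm_complex_def cmod_def power_divide)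
  have x0: "x s \<noteq> 0"
    using x_pos[OF assms] by simp
  note DERIV_add[OF DERIV_power[OF x2, of 2] DERIV_power[OF DERIV_divide[OF t2 deriv_x[OF assms] x0], of 2]]
  then obtain w' where w': "(w has_real_derivative w') (at s)"
    unfolding w_def by blast
  have sq: "((\<lambda>r. sqrt (w r)) has_real_derivative inverse (sqrt (w s)) / 2 * w') (at s)"
    by (rule DERIV_chain2[OF DERIV_real_sqrt[OF w] w'])
  have sq0: "sqrt (w s) \<noteq> 0"
    using w by simp
  note DERIV_divide[OF x2 sq sq0]
  moreover note DERIV_divide[OF DERIV_divide[OF DERIV_minus[OF t2] deriv_x[OF assms] x0] sq sq0]
  ultimately obtain p q where
    "((\<lambda>r. deriv x r / sqrt (w r)) has_vector_derivative p) (at s)"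
    "((\<lambda>r. - deriv t r / x r / sqrt (w r)) has_vector_derivative q) (at s)"
    by (auto simp: has_real_derivative_iff_has_vector_derivative)
  then have "((\<lambda>r. of_real (deriv x r / sqrt (w r)) + \<i> * of_real (- deriv t r / x r / sqrt (w r)))
      has_vector_derivative of_real p + \<i> * of_real q) (at s)"
    unfolding has_real_derivative_iff_has_vector_derivative[symmetric]
    by (intro has_vector_derivative_add has_vector_derivative_mult_right has_vector_derivative_of_real)
  moreover have "(\<lambda>r. of_real (deriv x r / sqrt (w r)) + \<i> * of_real (- deriv t r / x r / sqrt (w r))) = \<nu>"
    by (rule ext) (simp add: complex_eq_iff \<nu>_def sgn_div_norm norm, simp add: \<zeta>_def divide_inverse)
  ultimately show ?thesis
    using that by metis
qed

text \<open>
  \<open>rot_map\<close> is an immersion, so the velocity of the image curve determines the velocity in the parameter domain.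
\<close>

lemma velocity_in_frame:
  fixes \<omega> :: "complex ^ 'n::finite"
  assumes s: "s \<in> I" and \<omega>: "norm \<omega> = 1" and \<eta>: "\<eta> \<in> complex_perp \<omega>"
    and g: "curve_through (rot_dom I) (rot_map x t) (s, \<omega>) 
              (horiz (rot_map x t (s, \<omega>)) ((a *\<^sub>R \<zeta> s) *s \<omega> + \<eta>)) g"
  shows "((\<lambda>\<epsilon>. fst (g \<epsilon>)) has_real_derivative a) (at 0)"
    "((\<lambda>\<epsilon>. snd (g \<epsilon>)) has_vector_derivative (- a * deriv t s / (x s)\<^sup>2) *\<^sub>R (\<i> *s \<omega>) + \<eta> /\<^sub>R x s) (at 0)"
proof -
  let ?\<eta>' = "(- a * deriv t s / (x s)\<^sup>2) *\<^sub>R (\<i> *s \<omega>) + \<eta> /\<^sub>R x s"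
  obtain b \<theta> where b: "((\<lambda>\<epsilon>. fst (g \<epsilon>)) has_real_derivative b) (at 0)" 
    and \<theta>: "((\<lambda>\<epsilon>. snd (g \<epsilon>)) has_vector_derivative \<theta>) (at 0)" "inner \<omega> \<theta> = 0"
    and eq: "((a * deriv x s) *\<^sub>R \<omega> + x s *\<^sub>R ?\<eta>', a * deriv t s) =
      ((b * deriv x s) *\<^sub>R \<omega> + x s *\<^sub>R \<theta>, b * deriv t s)"
    using curve_through_velocity[OF s \<omega> g] unfolding horiz_frame[OF s \<omega> \<eta>] by metis
  have o: "inner \<omega> \<omega> = 1" "inner \<omega> (\<i> *s \<omega>) = 0" "inner \<omega> \<eta> = 0"
    using inner_smult_unit[OF \<omega>, of 1 1] inner_smult_unit[OF \<omega>, of 1 \<i>] \<eta>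
    by (simp_all add: inner_complex_def complex_perp_def inner_commute)
  have "inner \<omega> ((a * deriv x s) *\<^sub>R \<omega> + x s *\<^sub>R ?\<eta>') = inner \<omega> ((b * deriv x s) *\<^sub>R \<omega> + x s *\<^sub>R \<theta>)"
    using eq by simp
  then have "a * deriv x s = b * deriv x s"
    unfolding inner_add_right inner_scaleR_right o \<theta> by simp
  moreover have "a * deriv t s = b * deriv t s"
    using eq by simp
  ultimately have "a = b"
    using regular[OF s] by auto
  moreover from this have "?\<eta>' = \<theta>"
    using eq x_pos[OF s] by (metis add_left_cancel less_irrefl prod.inject scaleR_left_imp_eq)
  ultimately show "((\<lambda>\<epsilon>. fst (g \<epsilon>)) has_real_derivative a) (at 0)"
    "((\<lambda>\<epsilon>. snd (g \<epsilon>)) has_vector_derivative ?\<eta>') (at 0)"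
    using b \<theta> by auto
qed

text \<open>
  The connection only sees the frame coefficients \<open>\<i> \<nu>(s) \<omega>\<close> of \<open>e_2n\<close>, so its covariant derivative is the
  product rule. Its uniqueness relies on the existence of a curve with the given velocity.
\<close>

lemma has_cov_deriv_e_2n_iff:
  fixes \<omega> :: "complex ^ 'n::finite"
  assumes s: "s \<in> I" and \<omega>: "norm \<omega> = 1" and \<eta>: "\<eta> \<in> complex_perp \<omega>"
    and d: "(\<nu> has_vector_derivative d) (at s)"
  defines "p \<equiv> rot_map x t (s, \<omega>)"
  shows "has_cov_deriv (rot_dom I) (rot_map x t) (s, \<omega>) (horiz p ((a *\<^sub>R \<zeta> s) *s \<omega> + \<eta>)) (e_2n I x t) D \<longleftrightarrow>
    D = horiz p ((\<i> * (a *\<^sub>R d)) *s \<omega> + (\<i> * \<nu> s) *s ((- a * deriv t s / (x s)\<^sup>2) *\<^sub>R (\<i> *s \<omega>) + \<eta> /\<^sub>R x s))"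
    (is "?L \<longleftrightarrow> D = horiz p ?w")
proof -
  let ?v = "horiz p ((a *\<^sub>R \<zeta> s) *s \<omega> + \<eta>)"
  have deriv: "((\<lambda>\<epsilon>. fst (e_2n I x t (g \<epsilon>))) has_vector_derivative ?w) (at 0)"
    if g: "curve_through (rot_dom I) (rot_map x t) (s, \<omega>) ?v g" for g
  proof -
    note v = velocity_in_frame[OF s \<omega> \<eta> g[unfolded p_def]]
    have g0: "g 0 = (s, \<omega>)" and ev: "\<forall>\<^sub>F \<epsilon> in nhds 0. g \<epsilon> \<in> rot_dom I"
      using g by (auto simp: curve_through_def)
    have "((\<nu> \<circ> (\<lambda>\<epsilon>. fst (g \<epsilon>))) has_vector_derivative a *\<^sub>R d) (at 0)"
      using d by (intro vector_diff_chain_at) 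
        (simp_all add: v(1)[unfolded has_real_derivative_iff_has_vector_derivative] g0)
    then have \<nu>g: "((\<lambda>\<epsilon>. \<i> * \<nu> (fst (g \<epsilon>))) has_vector_derivative \<i> * (a *\<^sub>R d)) (at 0)"
      unfolding o_def by (rule has_vector_derivative_mult_right)
    have "((\<lambda>\<epsilon>. (\<i> * \<nu> (fst (g \<epsilon>))) *s snd (g \<epsilon>)) has_vector_derivative
      (\<i> * \<nu> (fst (g 0))) *s ((- a * deriv t s / (x s)\<^sup>2) *\<^sub>R (\<i> *s \<omega>) + \<eta> /\<^sub>R x s) + (\<i> * (a *\<^sub>R d)) *s snd (g 0)) (at 0)"
      by (rule bounded_bilinear.has_vector_derivative[OF bounded_bilinear_smult \<nu>g v(2)])
    moreover have "\<forall>\<^sub>F \<epsilon> in nhds 0. (\<i> * \<nu> (fst (g \<epsilon>))) *s snd (g \<epsilon>) = fst (e_2n I x t (g \<epsilon>))"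
      using ev by eventually_elim (auto simp: rot_dom_def e_2n_eq)
    ultimately show ?thesis
      using has_vector_derivative_eventually_eq by (fastforce simp: g0 add.commute)
  qed
  have "inner \<omega> ((- a * deriv t s / (x s)\<^sup>2) *\<^sub>R (\<i> *s \<omega>) + \<eta> /\<^sub>R x s) = 0"
    using inner_smult_unit[OF \<omega>, of 1 \<i>] \<eta>
    by (simp add: inner_complex_def complex_perp_def inner_commute[of \<omega> \<eta>] inner_diff_right)
  then obtain g where g: "curve_through (rot_dom I) (rot_map x t) (s, \<omega>) ?v g"
    using curve_through_exists[OF s \<omega>] unfolding p_def horiz_frame[OF s \<omega> \<eta>] by metis
  show ?thesis
  proof
    assume ?L
    then obtain w where "D = horiz p w" "((\<lambda>\<epsilon>. fst (e_2n I x t (g \<epsilon>))) has_vector_derivative w) (at 0)"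
      using g unfolding has_cov_deriv_def p_def by blast
    then show "D = horiz p ?w"
      using vector_derivative_unique_at[OF deriv[OF g]] by simp
  next
    assume "D = horiz p ?w"
    then show ?L
      using deriv unfolding has_cov_deriv_def p_def by blast
  qed
qed

lemma \<nu>_conv_\<zeta>: "\<nu> s = (1 / norm (\<zeta> s)) *\<^sub>R \<zeta> s"
  by (simp add: \<nu>_def sgn_div_norm divide_inverse)

text \<open>
  The hypothesis says that \<open>\<nu> = exp(\<i> \<phi>)\<close> has angular velocity \<open>\<phi>'\<close>. Writing it for \<open>\<nu>\<close> avoids choosing a
  branch of \<open>\<phi>\<close>.
\<close>

lemma inv_l_eq:
  fixes \<omega> :: "complex ^ 'n::finite"
  assumes s: "s \<in> I" and \<omega>: "norm \<omega> = 1" 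
    and \<nu>': "(\<nu> has_vector_derivative \<phi>' *\<^sub>R (\<i> * \<nu> s)) (at s)"
  shows "inv_l I x t (s, \<omega>) = (\<phi>' - deriv t s / (x s)\<^sup>2) / norm (\<zeta> s)"
proof -
  let ?p = "rot_map x t (s, \<omega>)" and ?a = "1 / norm (\<zeta> s)"
  have "(\<i> * (?a *\<^sub>R (\<phi>' *\<^sub>R (\<i> * \<nu> s)))) *s \<omega> + (\<i> * \<nu> s) *s ((- ?a * deriv t s / (x s)\<^sup>2) *\<^sub>R (\<i> *s \<omega>) + 0 /\<^sub>R x s)
      = - (((\<phi>' - deriv t s / (x s)\<^sup>2) * ?a) *\<^sub>R (\<nu> s *s \<omega>))"
    by (simp add: vec_eq_iff) (simp add: scaleR_conv_of_real algebra_simps diff_divide_distrib)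
  then have iff: "has_cov_deriv (rot_dom I) (rot_map x t) (s, \<omega>) (e_n I x t (s, \<omega>)) (e_2n I x t) D \<longleftrightarrow>
      D = horiz ?p (- (((\<phi>' - deriv t s / (x s)\<^sup>2) * ?a) *\<^sub>R (\<nu> s *s \<omega>)))" for D
    using has_cov_deriv_e_2n_iff[OF s \<omega> zero_complex_perp \<nu>', of ?a D] 
    by (simp add: e_n_eq[OF s \<omega>] \<nu>_conv_\<zeta>[symmetric])
  have "\<nu> s *s \<omega> \<noteq> 0"
    using norm_\<nu>[OF s] \<omega> norm_smult[of "\<nu> s" \<omega>] by auto
  then have "has_cov_deriv (rot_dom I) (rot_map x t) (s, \<omega>) (e_n I x t (s, \<omega>)) (e_2n I x t) (- (l *\<^sub>R e_n I x t (s, \<omega>))) \<longleftrightarrow>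
      l = (\<phi>' - deriv t s / (x s)\<^sup>2) * ?a" for l
    unfolding iff unfolding e_n_eq[OF s \<omega>] scaleR_horiz uminus_horiz horiz_inject by simp
  then show ?thesis
    by (simp add: inv_l_def)
qed

text \<open>
  On \<open>xi'\<close> the connection contributes \<open>- \<i> \<nu> / x\<close> and \<open>\<alpha> J\<close> contributes \<open>\<i> Re \<nu> / x\<close>; the imaginary multiples
  cancel and the real number \<open>Im \<nu> / x\<close> remains.
\<close>

lemma inv_k_eq:
  fixes \<omega> :: "complex ^ 'n::finite"
  assumes s: "s \<in> I" and \<omega>: "norm \<omega> = 1" 
  shows "inv_k I x t (s, \<omega>) = - deriv t s / ((x s)\<^sup>2 * norm (\<zeta> s))"
proof (cases "CARD('n) = 1")
  case True
  have "(x s * deriv x s)\<^sup>2 + (deriv t s)\<^sup>2 = (x s * norm (\<zeta> s))\<^sup>2"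
    using x_pos[OF s] by (simp add: \<zeta>_def power_mult_distrib cmod_power2 power_divide distrib_left)
  then have "sqrt ((x s * deriv x s)\<^sup>2 + (deriv t s)\<^sup>2) = x s * norm (\<zeta> s)"
    using x_pos[OF s] by simp
  then show ?thesis
    using True by (simp add: inv_k_def Let_def power2_eq_square mult.assoc)
next
  case False
  let ?p = "rot_map x t (s, \<omega>)"
  obtain d where d: "(\<nu> has_vector_derivative d) (at s)"
    by (rule \<nu>_differentiable[OF s])
  let ?k = "- deriv t s / ((x s)\<^sup>2 * norm (\<zeta> s))"
  have "(\<exists>D. has_cov_deriv (rot_dom I) (rot_map x t) (s, \<omega>) (horiz ?p \<eta>) (e_2n I x t) D \<and>
           - D + inv_alpha I x t (s, \<omega>) *\<^sub>R J_op ?p (horiz ?p \<eta>) = k *\<^sub>R horiz ?p \<eta>) \<longleftrightarrow> ?k *\<^sub>R \<eta> = k *\<^sub>R \<eta>"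
    if \<eta>: "\<eta> \<in> complex_perp \<omega>" for \<eta> k
  proof -
    have "- ((\<i> * \<nu> s) *s (\<eta> /\<^sub>R x s)) + (deriv x s / (x s * norm (\<zeta> s))) *\<^sub>R (\<i> *s \<eta>)
        = (- (\<i> * \<nu> s) / of_real (x s) + \<i> * of_real (deriv x s / (x s * norm (\<zeta> s)))) *s \<eta>"
      by (simp add: vec_eq_iff) (simp add: scaleR_conv_of_real algebra_simps divide_inverse)
    also have "- (\<i> * \<nu> s) / of_real (x s) + \<i> * of_real (deriv x s / (x s * norm (\<zeta> s))) = of_real ?k"
      using x_pos[OF s] \<zeta>_nz[OF s]
      by (simp add: \<nu>_conv_\<zeta> complex_eq_iff, simp add: \<zeta>_def power2_eq_square)
    also have "complex_of_real ?k *s \<eta> = ?k *\<^sub>R \<eta>"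
      unfolding vec_eq_iff vector_scaleR_component vector_smult_component by (simp only: scaleR_conv_of_real simp_thms)
    finally have "- ((\<i> * \<nu> s) *s (\<eta> /\<^sub>R x s)) + (deriv x s / (x s * norm (\<zeta> s))) *\<^sub>R (\<i> *s \<eta>) = ?k *\<^sub>R \<eta>" .
    then have "- horiz ?p ((\<i> * \<nu> s) *s (\<eta> /\<^sub>R x s)) + inv_alpha I x t (s, \<omega>) *\<^sub>R J_op ?p (horiz ?p \<eta>) = horiz ?p (?k *\<^sub>R \<eta>)"
      by (simp only: inv_alpha_eq[OF s \<omega>] J_op_def fst_horiz scaleR_horiz uminus_horiz add_horiz)
    moreover have "has_cov_deriv (rot_dom I) (rot_map x t) (s, \<omega>) (horiz ?p \<eta>) (e_2n I x t) D \<longleftrightarrow>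
        D = horiz ?p ((\<i> * \<nu> s) *s (\<eta> /\<^sub>R x s))" for D
      using has_cov_deriv_e_2n_iff[OF s \<omega> \<eta> d, of 0 D] by simp
    ultimately show ?thesis
      by (simp add: scaleR_horiz horiz_inject)
  qed
  then have iff: "(\<forall>v \<in> xi' (rot_dom I) (rot_map x t) (s, \<omega>).
      \<exists>D. has_cov_deriv (rot_dom I) (rot_map x t) (s, \<omega>) v (e_2n I x t) D \<and>
          - D + inv_alpha I x t (s, \<omega>) *\<^sub>R J_op ?p v = k *\<^sub>R v) \<longleftrightarrow> (\<forall>\<eta>\<in>complex_perp \<omega>. ?k *\<^sub>R \<eta> = k *\<^sub>R \<eta>)" for k
    unfolding xi'_eq[OF s \<omega>] ball_simps by blast
  obtain \<eta> where "\<eta> \<in> complex_perp \<omega>" "\<eta> \<noteq> 0"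
    using complex_perp_nontrivial[OF False] .
  then have "(\<forall>\<eta>\<in>complex_perp \<omega>. ?k *\<^sub>R \<eta> = k *\<^sub>R \<eta>) \<longleftrightarrow> k = ?k" for k
    by (metis scaleR_right_imp_eq)
  then show ?thesis
    using False by (simp only: inv_k_def iff if_False the_eq_trivial)
qed

end

lemma generates_generating_curve: "generates I x t S \<Longrightarrow> generating_curve I x t"
  by unfold_locales (auto simp: generates_def)

section \<open>The profile function of an energy level\<close>

locale energy_level =
  fixes c E :: real and n :: nat
  assumes c_pos: "c > 0" and n_pos: "n > 0"
begin

text \<open>
  \<open>\<Lambda>\<close> is the constant \<open>\<lambda>\<close> with \<open>c = 2 n \<lambda>\<close>. The energy \<open>E_min\<close> is that of the cylinder of radius \<open>\<rho>\<close>.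
\<close>

definition \<Lambda> :: real where "\<Lambda> = c / (2 * real n)"

definition m :: nat where "m = 2 * n - 1"

definition \<rho> :: real where "\<rho> = real m / c"

definition E_min :: real where "E_min = - (\<rho> ^ m / (2 * real n))"

text \<open>
  On a curve of energy \<open>E\<close>, the value of \<open>sin \<phi>\<close> at radius \<open>u\<close> is \<open>\<psi> u\<close>.
\<close>

definition \<psi> :: "real \<Rightarrow> real" where
  "\<psi> u = u * (\<Lambda> - E / u ^ (2 * n))"

definition \<psi>' :: "real \<Rightarrow> real" where
  "\<psi>' u = \<Lambda> + real m * E / u ^ (2 * n)"

definition U :: "real set" where
  "U = {u. u > 0 \<and> (\<psi> u)\<^sup>2 < 1}"

lemma \<Lambda>_pos: "\<Lambda> > 0" and m_pos: "m > 0" and two_n: "2 * n = Suc m" "2 * real n = real m + 1" 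
  and \<rho>_pos: "\<rho> > 0"
  using c_pos n_pos by (auto simp: \<Lambda>_def m_def \<rho>_def)

lemma \<Lambda>_\<rho>: "\<Lambda> * \<rho> = real m / (real m + 1)"
  using c_pos by (simp add: \<Lambda>_def \<rho>_def two_n)

lemma \<psi>_eq: "u > 0 \<Longrightarrow> \<psi> u = \<Lambda> * u - E / u ^ m"
  unfolding \<psi>_def two_n(1) by (simp add: right_diff_distrib)

text \<open>
  This is the equation \<open>H = c\<close> for a curve parametrised by horizontal arc-length: there \<open>l = \<psi>' + \<psi> / u\<close> and
  \<open>k = \<psi> / u\<close>.
\<close>

lemma \<psi>_ode: "u > 0 \<Longrightarrow> \<psi>' u + real m * (\<psi> u / u) = c"
proof -
  assume "u > 0"
  then have "\<psi>' u + real m * (\<psi> u / u) = (1 + real m) * \<Lambda>"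
    by (simp add: \<psi>'_def \<psi>_def distrib_right) (simp add: algebra_simps)
  also have "\<dots> = c"
    by (simp add: \<Lambda>_def two_n add.commute)
  finally show ?thesis .
qed

lemma \<psi>_deriv: 
  assumes "u > 0" shows "(\<psi> has_real_derivative \<psi>' u) (at u)"
proof -
  have pw: "((\<lambda>u. u ^ Suc m) has_real_derivative (1 + real m) * u ^ m) (at u)"
    using DERIV_pow[of "Suc m" u] by simp
  have "(\<psi> has_real_derivative 1 * (\<Lambda> - E / u ^ Suc m)
      + (0 - (0 * u ^ Suc m - E * ((1 + real m) * u ^ m)) / (u ^ Suc m * u ^ Suc m)) * u) (at u)"
    unfolding \<psi>_def two_n(1) using assms
    by (intro DERIV_mult DERIV_diff DERIV_divide DERIV_const DERIV_ident pw) auto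
  also have "1 * (\<Lambda> - E / u ^ Suc m)
      + (0 - (0 * u ^ Suc m - E * ((1 + real m) * u ^ m)) / (u ^ Suc m * u ^ Suc m)) * u = \<psi>' u"
    unfolding \<psi>'_def two_n(1) using assms by (simp add: field_simps)
  finally show ?thesis .
qed

lemma \<psi>_isCont: "u > 0 \<Longrightarrow> isCont \<psi> u"
  using \<psi>_deriv DERIV_isCont by blast

lemma \<psi>'_isCont: "u > 0 \<Longrightarrow> isCont \<psi>' u"
  unfolding \<psi>'_def by (intro continuous_intros) auto

text \<open>
  With \<open>u = \<rho> v\<close> the claim becomes \<open>(m + 1) v^m - m v^(m+1) \<le> 1\<close>. This is Bernoulli's inequality for the
  power \<open>m + 1\<close> of \<open>1 / v = 1 + (1 / v - 1)\<close>, multiplied by \<open>v^(m+1)\<close>.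
\<close>

lemma profile_min:
  assumes "u > 0"
  shows "E_min \<le> \<Lambda> * u ^ Suc m - u ^ m"
proof -
  define v where "v = u / \<rho>"
  have v: "v > 0" "u = \<rho> * v"
    using assms \<rho>_pos by (auto simp: v_def)
  have "1 + real (Suc m) * (1 / v - 1) \<le> (1 + (1 / v - 1)) ^ Suc m"
    using v by (intro Bernoulli_inequality) simp
  then have "(1 + real (Suc m) * (1 / v - 1)) * v ^ Suc m \<le> (1 / v) ^ Suc m * v ^ Suc m"
    using v by (intro mult_right_mono) auto
  also have "(1 / v) ^ Suc m * v ^ Suc m = 1"
    using v by (simp add: power_mult_distrib[symmetric])
  also have "(1 + real (Suc m) * (1 / v - 1)) * v ^ Suc m = (real m + 1) * v ^ m - real m * v ^ Suc m"
    using v by (simp add: field_simps)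
  finally have "(real m + 1) * v ^ m - real m * v ^ Suc m \<le> 1" .
  then have "\<rho> ^ m * ((real m + 1) * v ^ m - real m * v ^ Suc m) / (real m + 1) \<le> \<rho> ^ m * 1 / (real m + 1)"
    using \<rho>_pos by (intro divide_right_mono mult_left_mono) auto
  also have "\<rho> ^ m * ((real m + 1) * v ^ m - real m * v ^ Suc m) / (real m + 1)
      = \<rho> ^ m * (v ^ m - real m / (real m + 1) * v ^ Suc m)"
    by (simp add: field_simps)
  also have "\<dots> = \<rho> ^ m * (v ^ m - \<Lambda> * \<rho> * v ^ Suc m)"
    by (simp only: \<Lambda>_\<rho>)
  also have "\<dots> = u ^ m - \<Lambda> * u ^ Suc m"
    by (simp add: v power_mult_distrib algebra_simps)
  finally show ?thesis
    by (simp add: E_min_def two_n)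
qed

lemma \<psi>_\<rho>: "\<psi> \<rho> = 1 - (E - E_min) / \<rho> ^ m"
proof -
  have "E_min / \<rho> ^ m = - (1 / (real m + 1))"
    using \<rho>_pos by (simp add: E_min_def two_n)
  moreover have "real m / (real m + 1) = 1 - 1 / (real m + 1)"
    by (simp add: field_simps)
  ultimately show ?thesis
    using \<psi>_eq[OF \<rho>_pos] \<Lambda>_\<rho> by (simp add: diff_divide_distrib)
qed

lemma \<psi>_ge_1: "E \<le> E_min \<Longrightarrow> u > 0 \<Longrightarrow> \<psi> u \<ge> 1"
proof -
  assume "E \<le> E_min" "u > 0"
  then have "u ^ m \<le> \<Lambda> * u ^ Suc m - E"
    using profile_min[of u] by simp
  then have "u ^ m / u ^ m \<le> (\<Lambda> * u ^ Suc m - E) / u ^ m"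
    using \<open>u > 0\<close> by (intro divide_right_mono) auto
  then show ?thesis
    using \<open>u > 0\<close> by (simp add: \<psi>_eq diff_divide_distrib)
qed

lemma U_pos: "u \<in> U \<Longrightarrow> u > 0" and U_less: "u \<in> U \<Longrightarrow> \<psi> u < 1" "u \<in> U \<Longrightarrow> \<psi> u > - 1"
  by (auto simp: U_def abs_square_less_1)

lemma mem_U: "u > 0 \<Longrightarrow> - 1 < \<psi> u \<Longrightarrow> \<psi> u < 1 \<Longrightarrow> u \<in> U"
  by (auto simp: U_def abs_square_less_1)

lemma \<psi>'_mono: "0 < u \<Longrightarrow> u \<le> v \<Longrightarrow> E \<le> 0 \<Longrightarrow> \<psi>' u \<le> \<psi>' v"
proof -
  assume a: "0 < u" "u \<le> v" "E \<le> 0"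
  have "(real m * (- E)) / v ^ (2 * n) \<le> (real m * (- E)) / u ^ (2 * n)"
    using a by (intro divide_left_mono power_mono) (auto simp: mult_nonneg_nonpos)
  then show ?thesis by (simp add: \<psi>'_def)
qed

lemma \<psi>'_ge: "u > 0 \<Longrightarrow> E \<ge> 0 \<Longrightarrow> \<psi>' u \<ge> \<Lambda>"
  by (simp add: \<psi>'_def)

lemma \<psi>_mono: 
  assumes "0 < u" "u \<le> v" "E \<ge> 0"
  shows "\<psi> u \<le> \<psi> v"
proof (rule DERIV_nonneg_imp_nondecreasing[OF assms(2)])
  fix w assume "u \<le> w" "w \<le> v"
  then show "\<exists>y. (\<psi> has_real_derivative y) (at w) \<and> 0 \<le> y"
    using assms \<psi>_deriv[of w] \<psi>'_ge[of w] \<Lambda>_pos by (intro exI[of _ "\<psi>' w"]) auto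
qed

lemma \<psi>_convex: "E \<le> 0 \<Longrightarrow> convex_on {0<..} \<psi>"
  by (rule convex_on_realI[of _ _ \<psi>']) (simp_all add: \<psi>_deriv \<psi>'_mono is_interval_connected)

lemma \<psi>_pos: "E \<le> 0 \<Longrightarrow> u > 0 \<Longrightarrow> \<psi> u > 0"
  using \<Lambda>_pos divide_nonpos_pos[of E "u ^ (2 * n)"] by (simp add: \<psi>_def)

text \<open>
  For \<open>E \<ge> 0\<close> the function \<open>\<psi>\<close> is increasing. For \<open>E < 0\<close> it is positive, so only \<open>\<psi> < 1\<close> matters, which is a
  sublevel condition on a convex function.
\<close>

lemma is_interval_U: "is_interval U"
  unfolding is_interval_1
proof (intro ballI allI impI)
  fix u v w assume "u \<in> U" "v \<in> U" "u \<le> w \<and> w \<le> v"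
  then have uvw: "u \<in> U \<and> v \<in> U \<and> u \<le> w \<and> w \<le> v" by simp
  then have w: "w > 0" and u: "u > 0" and v: "v > 0" using U_pos[of u] U_pos[of v] by auto
  show "w \<in> U"
  proof (cases "E \<ge> 0")
    case True
    then show ?thesis
      using uvw u w \<psi>_mono[of u w] \<psi>_mono[of w v] U_less[of u] U_less[of v]
      by (intro mem_U) auto
  next
    case False
    have "convex_on {u..v} \<psi>"
      using False u by (intro convex_on_subset[OF \<psi>_convex]) auto
    then have "\<psi> w \<le> max (\<psi> u) (\<psi> v)"
      using uvw by (intro convex_on_le_max) auto
    then show ?thesis
      using \<psi>_pos[OF _ w] False U_less[of u] U_less[of v] uvw w by (intro mem_U) auto
  qed
qed

lemma open_U: "open U"
proof -
  have "U = {u \<in> {0<..}. \<psi> u \<in> {- 1 <..< 1}}"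
    by (auto simp: U_def abs_square_less_1)
  moreover have "continuous_on {0<..} \<psi>"
    by (intro continuous_at_imp_continuous_on ballI \<psi>_isCont) auto
  ultimately show ?thesis
    using continuous_open_preimage[of "{0<..}" \<psi> "{- 1 <..< 1}"] by (simp add: vimage_def Int_def)
qed

lemma U_bounded: "u \<in> U \<Longrightarrow> u < max 1 ((1 + \<bar>E\<bar>) / \<Lambda>)"
proof (rule ccontr)
  assume u: "u \<in> U" and "\<not> u < max 1 ((1 + \<bar>E\<bar>) / \<Lambda>)"
  then have 1: "1 \<le> u" and 2: "(1 + \<bar>E\<bar>) / \<Lambda> \<le> u" by auto
  have "E / u ^ m \<le> \<bar>E\<bar> / 1"
    using 1 by (intro frac_le) auto
  moreover have "1 + \<bar>E\<bar> \<le> \<Lambda> * u"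
    using 2 \<Lambda>_pos by (simp add: field_simps)
  ultimately show False
    using U_less[OF u] 1 by (simp add: \<psi>_eq)
qed

text \<open>
  For \<open>E \<le> 0\<close> the radius \<open>\<rho>\<close> lies in \<open>U\<close>; for \<open>E > 0\<close> the zero of \<open>\<psi>\<close> does.
\<close>

lemma U_nonempty:
  assumes "E > E_min"
  shows "U \<noteq> {}"
proof -
  have less: "\<psi> \<rho> < 1"
    using assms \<rho>_pos by (simp add: \<psi>_\<rho>)
  show ?thesis
  proof (cases "E \<le> 0")
    case True
    then show ?thesis
      using mem_U[OF \<rho>_pos _ less] \<psi>_pos[OF True \<rho>_pos] by auto
  next
    case False
    define u where "u = root (2 * n) (E / \<Lambda>)"
    have "u > 0" "u ^ (2 * n) = E / \<Lambda>"
      using False n_pos \<Lambda>_pos by (auto simp: u_def)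
    then have "\<psi> u = 0"
      using False by (simp add: \<psi>_def)
    then show ?thesis
      using mem_U[OF \<open>u > 0\<close>] by auto
  qed
qed

lemma U_interval:
  assumes "E > E_min"
  obtains a b where "0 \<le> a" "a < b" "U = {a<..<b}"
proof -
  have bdd: "bdd_above U" "bdd_below U"
    using U_bounded U_pos by (meson bdd_aboveI bdd_belowI less_imp_le)+
  note ne = U_nonempty[OF assms]
  have "U = {Inf U<..<Sup U}"
  proof (intro equalityI subsetI)
    fix u assume u: "u \<in> U"
    obtain e where e: "e > 0" "\<And>v. \<bar>v - u\<bar> < e \<Longrightarrow> v \<in> U"
      using open_U u by (auto simp: open_real)
    have "u - e / 2 \<in> U" "u + e / 2 \<in> U"
      using e by (auto intro!: e(2))
    then have "Inf U \<le> u - e / 2" "u + e / 2 \<le> Sup U"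
      using bdd by (auto intro: cInf_lower cSup_upper)
    then show "u \<in> {Inf U<..<Sup U}" using e(1) by auto
  next
    fix u assume "u \<in> {Inf U<..<Sup U}"
    then obtain v w where "v \<in> U" "w \<in> U" "v < u" "u < w"
      using cInf_lessD[OF ne, of u] less_cSupD[OF ne, of u] by auto
    then show "u \<in> U"
      using is_interval_U unfolding is_interval_1 by (meson less_imp_le)
  qed
  moreover have "0 \<le> Inf U"
    using ne U_pos by (intro cInf_greatest) (auto intro: less_imp_le)
  moreover have "Inf U < Sup U"
    using ne calculation(1) by (metis greaterThanLessThan_empty_iff not_less)
  ultimately show ?thesis
    using that by blast
qed

lemma U_cont: 
  assumes "u \<in> U" shows "isCont (\<lambda>u. sqrt (1 - (\<psi> u)\<^sup>2)) u" "sqrt (1 - (\<psi> u)\<^sup>2) > 0"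
  using \<psi>_isCont[OF U_pos[OF assms]] assms by (auto intro!: continuous_intros simp: U_def)

lemma antiderivative_on_U:
  assumes "E > E_min" "\<And>u. u \<in> U \<Longrightarrow> isCont f u"
  obtains F where "\<And>u. u \<in> U \<Longrightarrow> (F has_real_derivative f u) (at u)"
proof -
  obtain a b where ab: "a < b" "U = {a<..<b}"
    using U_interval[OF assms(1)] by metis
  have "\<exists>F. \<forall>u. ereal a < ereal u \<longrightarrow> ereal u < ereal b \<longrightarrow> (F has_vector_derivative f u) (at u)"
    using ab assms(2) by (intro einterval_antiderivative) auto
  then show ?thesis
    using that ab by (auto simp: has_real_derivative_iff_has_vector_derivative)
qed

text \<open>
  The quotient \<open>t' / x'\<close> along a curve of energy \<open>E\<close> with \<open>x' > 0\<close>; see \<open>level_curve_is_graph\<close>.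
\<close>

definition height_slope :: "real \<Rightarrow> real" where
  "height_slope u = - (u * \<psi> u / sqrt (1 - (\<psi> u)\<^sup>2))"

lemma arcsin_\<psi>_bounds: "u \<in> U \<Longrightarrow> \<bar>arcsin (\<psi> u)\<bar> \<le> pi / 2"
  using U_less[of u] arcsin_bounded[of "\<psi> u"] by auto

text \<open>
  Comparison with \<open>arcsin \<circ> \<psi>\<close>, whose derivative \<open>\<psi>' / sqrt (1 - \<psi>\<^sup>2)\<close> has the same singularity as \<open>height_slope\<close>,
  but whose values stay within \<open>\<plusminus> pi / 2\<close>.
\<close>

lemma height_variation_bound:
  assumes h: "\<And>u. u \<in> U \<Longrightarrow> (h has_real_derivative height_slope u) (at u)"
    and ab: "U = {a<..<b}" and uv: "u \<in> U" "v \<in> U" "u \<le> v"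
    and \<kappa>: "\<kappa> > 0" "\<And>w. u \<le> w \<Longrightarrow> w \<le> v \<Longrightarrow> \<kappa> \<le> \<psi>' w"
  shows "\<bar>h v - h u\<bar> \<le> b / \<kappa> * pi"
proof -
  let ?K = "b / \<kappa>"
  have b: "b > 0"
    using U_pos[OF uv(1)] uv(1) unfolding ab by auto
  have inU: "w \<in> U" if "u \<le> w" "w \<le> v" for w
    using that uv unfolding ab by auto
  have as: "((\<lambda>u. arcsin (\<psi> u)) has_real_derivative \<psi>' w / sqrt (1 - (\<psi> w)\<^sup>2)) (at w)" if "w \<in> U" for w
    using DERIV_chain2[OF DERIV_arcsin \<psi>_deriv[OF U_pos[OF that]]] U_less[OF that]
    by (simp add: divide_inverse mult.commute)
  have le: "\<bar>height_slope w\<bar> \<le> ?K * (\<psi>' w / sqrt (1 - (\<psi> w)\<^sup>2))" if "u \<le> w" "w \<le> v" for w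
  proof -
    note w = inU[OF that]
    have "\<bar>w * \<psi> w\<bar> \<le> b * 1"
      unfolding abs_mult using U_pos[OF w] U_less[OF w] w by (intro mult_mono) (auto simp: ab)
    also have "\<dots> \<le> ?K * \<psi>' w"
      using \<kappa>(2)[OF that] \<kappa>(1) b by (simp add: field_simps)
    finally have "\<bar>w * \<psi> w\<bar> / sqrt (1 - (\<psi> w)\<^sup>2) \<le> (?K * \<psi>' w) / sqrt (1 - (\<psi> w)\<^sup>2)"
      using U_cont(2)[OF w] by (intro divide_right_mono) auto
    then show ?thesis
      using U_cont(2)[OF w] by (simp add: height_slope_def)
  qed
  have "h u + ?K * arcsin (\<psi> u) \<le> h v + ?K * arcsin (\<psi> v)"
  proof (rule DERIV_nonneg_imp_nondecreasing[OF uv(3)])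
    fix w assume w: "u \<le> w" "w \<le> v"
    show "\<exists>y. ((\<lambda>w. h w + ?K * arcsin (\<psi> w)) has_real_derivative y) (at w) \<and> 0 \<le> y"
      using DERIV_add[OF h[OF inU[OF w]] DERIV_cmult[OF as[OF inU[OF w]], of ?K]] le[OF w]
      by (intro exI conjI) (auto simp: abs_le_iff)
  qed
  moreover have "h v - ?K * arcsin (\<psi> v) \<le> h u - ?K * arcsin (\<psi> u)"
  proof (rule DERIV_nonpos_imp_nonincreasing[OF uv(3)])
    fix w assume w: "u \<le> w" "w \<le> v"
    show "\<exists>y. ((\<lambda>w. h w - ?K * arcsin (\<psi> w)) has_real_derivative y) (at w) \<and> y \<le> 0"
      using DERIV_diff[OF h[OF inU[OF w]] DERIV_cmult[OF as[OF inU[OF w]], of ?K]] le[OF w]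
      by (intro exI conjI) (auto simp: abs_le_iff)
  qed
  ultimately have "\<bar>h v - h u\<bar> \<le> ?K * (arcsin (\<psi> v) - arcsin (\<psi> u))"
    unfolding right_diff_distrib by linarith
  also have "\<dots> \<le> ?K * pi"
    using arcsin_\<psi>_bounds[OF uv(1)] arcsin_\<psi>_bounds[OF uv(2)] b \<kappa>(1)
    by (intro mult_left_mono) auto
  finally show ?thesis .
qed

text \<open>
  For \<open>E \<ge> 0\<close> the comparison applies on all of \<open>U\<close> because \<open>\<psi>' \<ge> \<Lambda>\<close>. For \<open>E < 0\<close> it applies to the right of \<open>\<rho>\<close>,
  where \<open>\<psi>' \<ge> \<psi>' \<rho> = c (1 - \<psi> \<rho>) > 0\<close>; to the left of \<open>\<rho>\<close> the height is decreasing because \<open>\<psi> > 0\<close>.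
\<close>

lemma height_bounded_below:
  assumes "E > E_min" and h: "\<And>u. u \<in> U \<Longrightarrow> (h has_real_derivative height_slope u) (at u)"
  obtains B where "\<And>u. u \<in> U \<Longrightarrow> B \<le> h u"
proof -
  obtain a b where ab: "U = {a<..<b}"
    using U_interval[OF assms(1)] by metis
  show ?thesis
  proof (cases "E \<ge> 0")
    case True
    obtain v where v: "v \<in> U"
      using U_nonempty[OF assms(1)] by blast
    have "h v - b / \<Lambda> * pi \<le> h u" if u: "u \<in> U" for u
    proof (cases "u \<le> v")
      case True': True
      then show ?thesis
        using height_variation_bound[OF h ab u v True' \<Lambda>_pos] \<psi>'_ge[OF _ True] U_pos[OF u] by force
    next
      case False
      then show ?thesis
        using height_variation_bound[OF h ab v u _ \<Lambda>_pos] \<psi>'_ge[OF _ True] U_pos[OF v] by force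
    qed
    then show ?thesis using that by blast
  next
    case False
    have less: "\<psi> \<rho> < 1"
      using assms \<rho>_pos by (simp add: \<psi>_\<rho>)
    have \<rho>: "\<rho> \<in> U"
      using mem_U[OF \<rho>_pos _ less] \<psi>_pos[OF _ \<rho>_pos] False by auto
    have "\<psi>' \<rho> = c * (1 - \<psi> \<rho>)"
      using \<psi>_ode[OF \<rho>_pos] m_pos c_pos by (simp add: \<rho>_def field_simps)
    then have pos: "\<psi>' \<rho> > 0"
      using less c_pos by simp
    have "h \<rho> - \<bar>b / \<psi>' \<rho> * pi\<bar> \<le> h u" if u: "u \<in> U" for u
    proof (cases "\<rho> \<le> u")
      case True
      have "\<bar>h u - h \<rho>\<bar> \<le> b / \<psi>' \<rho> * pi"
        using \<psi>'_mono[OF \<rho>_pos] False by (intro height_variation_bound[OF h ab \<rho> u True pos]) auto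
      then show ?thesis by linarith
    next
      case le: False
      have "h \<rho> \<le> h u"
      proof (rule DERIV_nonpos_imp_nonincreasing[of u \<rho>])
        show "u \<le> \<rho>" using le by simp
      next
        fix w assume w: "u \<le> w" "w \<le> \<rho>"
        have wU: "w \<in> U" using w u \<rho> unfolding ab by auto
        then show "\<exists>y. (h has_real_derivative y) (at w) \<and> y \<le> 0"
          using h[OF wU] \<psi>_pos[OF _ U_pos[OF wU]] False U_pos[OF wU] U_cont(2)[OF wU]
          by (intro exI[of _ "height_slope w"]) (auto simp: height_slope_def)
      qed
      then show ?thesis by linarith
    qed
    then show ?thesis using that by blast
  qed
qed

end

section \<open>Curves of constant energy\<close>

text \<open>
  The derivatives are given by \<open>f1\<close> and \<open>f2\<close> on \<open>I\<close> only, whereas \<open>deriv f\<close> is a function on all reals; openness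
  of \<open>I\<close> bridges the difference.
\<close>

lemma C2_onI:
  assumes "open I" "\<And>s. s \<in> I \<Longrightarrow> (f has_real_derivative f1 s) (at s)"
    "\<And>s. s \<in> I \<Longrightarrow> (f1 has_real_derivative f2 s) (at s)" "\<And>s. s \<in> I \<Longrightarrow> isCont f2 s"
  shows "C2_on I f"
proof -
  have 1: "deriv f s = f1 s" if "s \<in> I" for s
    using assms(2)[OF that] by (rule DERIV_imp_deriv)
  have 2: "(deriv f has_real_derivative f2 s) (at s)" if "s \<in> I" for s
    using has_field_derivative_transform_within_open[OF assms(3)[OF that] assms(1) that] 1 by metis
  have "continuous_on I f2"
    using assms(4) by (simp add: continuous_at_imp_continuous_on)
  then have "continuous_on I (deriv (deriv f))"
    by (rule continuous_on_eq) (metis 2 DERIV_imp_deriv)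
  then show ?thesis
    using assms(2) 2 by (auto simp: C2_on_def field_differentiable_def)
qed

locale curve_at_level = generating_curve I x t + energy_level c E n for I x t c E n
begin

lemma \<nu>_parts: "Re (\<nu> s) = deriv x s / norm (\<zeta> s)" "Im (\<nu> s) = - deriv t s / (x s * norm (\<zeta> s))"
  by (simp_all add: \<nu>_conv_\<zeta>) (simp_all add: \<zeta>_def)

lemma inv_k_conv_\<nu>:
  fixes \<omega> :: "complex ^ 'n::finite"
  assumes "s \<in> I" "norm \<omega> = 1"
  shows "inv_k I x t (s, \<omega>) = Im (\<nu> s) / x s"
  by (simp add: inv_k_eq[OF assms] \<nu>_parts power2_eq_square mult.commute mult.left_commute)

lemma inv_alpha_conv_\<nu>:
  fixes \<omega> :: "complex ^ 'n::finite"
  assumes "s \<in> I" "norm \<omega> = 1"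
  shows "inv_alpha I x t (s, \<omega>) = Re (\<nu> s) / x s"
  by (simp add: inv_alpha_eq[OF assms] \<nu>_parts mult.commute)

lemma energy_conv_\<nu>:
  fixes \<omega> :: "complex ^ 'n::finite"
  assumes "n = CARD('n)" "s \<in> I" "norm \<omega> = 1"
  shows "energy c I x t (s, \<omega>) = \<Lambda> * x s ^ Suc m - Im (\<nu> s) * x s ^ m"
  using x_pos[OF assms(2)] 
  by (simp add: energy_def inv_k_conv_\<nu>[OF assms(2,3)] assms(1)[symmetric] \<Lambda>_def[symmetric] two_n(1) left_diff_distrib)

lemma energy_iff:
  fixes \<omega> :: "complex ^ 'n::finite"
  assumes "n = CARD('n)" "s \<in> I" "norm \<omega> = 1"
  shows "energy c I x t (s, \<omega>) = E \<longleftrightarrow> Im (\<nu> s) = \<psi> (x s)"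
  using x_pos[OF assms(2)] by (auto simp: energy_conv_\<nu>[OF assms] \<psi>_eq field_simps)

text \<open>
  This is \<open>profile_min\<close> combined with \<open>Im \<nu> = sin \<phi> \<le> 1\<close>.
\<close>

lemma energy_ge_min:
  fixes \<omega> :: "complex ^ 'n::finite"
  assumes "n = CARD('n)" "s \<in> I" "norm \<omega> = 1"
  shows "energy c I x t (s, \<omega>) \<ge> E_min"
proof -
  have "Im (\<nu> s) \<le> 1"
    using abs_Im_le_cmod[of "\<nu> s"] norm_\<nu>[OF assms(2)] by simp
  then have "Im (\<nu> s) * x s ^ m \<le> 1 * x s ^ m"
    using x_pos[OF assms(2)] by (intro mult_right_mono) auto
  then show ?thesis
    using profile_min[OF x_pos[OF assms(2)]] by (simp add: energy_conv_\<nu>[OF assms])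
qed

lemma p_mean_curvature_eq:
  fixes \<omega> :: "complex ^ 'n::finite"
  assumes "n = CARD('n)" "s \<in> I" "norm \<omega> = 1" 
    and "(\<nu> has_vector_derivative \<phi>' *\<^sub>R (\<i> * \<nu> s)) (at s)"
  shows "p_mean_curvature I x t (s, \<omega>) = \<phi>' / norm (\<zeta> s) + real m * (Im (\<nu> s) / x s)"
proof -
  have "2 * real CARD('n) - 2 = real m - 1"
    using two_n(2) assms(1) by simp
  moreover have "(\<phi>' - deriv t s / (x s)\<^sup>2) / norm (\<zeta> s) = \<phi>' / norm (\<zeta> s) + Im (\<nu> s) / x s"
    by (simp add: \<nu>_parts diff_divide_distrib power2_eq_square mult_ac)
  moreover have "a + (real m - 1) * a = real m * a" for a
    by (simp add: left_diff_distrib)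
  ultimately show ?thesis
    by (simp only: p_mean_curvature_def inv_l_eq[OF assms(2-4)] inv_k_conv_\<nu>[OF assms(2,3)] add.assoc)
qed

end

context energy_level
begin

text \<open>
  The converse of \<open>energy_iff\<close>: the prescribed derivatives say \<open>\<nu> = \<zeta> = \<sigma> sqrt (1 - (\<psi> x)\<^sup>2) + \<i> \<psi> x\<close>, whose
  angular velocity is \<open>\<psi>' x\<close>, and \<open>\<psi>_ode\<close> turns this into \<open>H = c\<close>.
\<close>

lemma solution_curve:
  fixes x t :: "real \<Rightarrow> real"
  assumes n: "n = CARD('n::finite)" and I: "open I" "is_interval I" "I \<noteq> {}" and \<sigma>: "\<sigma> * \<sigma> = (1 :: real)"
    and xU: "\<And>s. s \<in> I \<Longrightarrow> x s \<in> U"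
    and x': "\<And>s. s \<in> I \<Longrightarrow> (x has_real_derivative \<sigma> * sqrt (1 - (\<psi> (x s))\<^sup>2)) (at s)"
    and t': "\<And>s. s \<in> I \<Longrightarrow> (t has_real_derivative - (\<psi> (x s) * x s)) (at s)"
  shows "const_pmc_energy c E I x t (rot_map x t ` rot_dom I :: 'n heis set)"
    "horizontal_arclength I x t"
    "\<forall>q \<in> rot_dom I :: (real \<times> (complex ^ 'n)) set. inv_alpha I x t q \<noteq> 0"
proof -
  let ?r = "\<lambda>s. sqrt (1 - (\<psi> (x s))\<^sup>2)"
  have \<psi>x: "((\<lambda>s. \<psi> (x s)) has_real_derivative \<psi>' (x s) * (\<sigma> * ?r s)) (at s)" if "s \<in> I" for s
    by (rule DERIV_chain2[OF \<psi>_deriv[OF U_pos[OF xU[OF that]]] x'[OF that]])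
  have r_pos: "?r s > 0" if "s \<in> I" for s
    using U_cont(2)[OF xU[OF that]] .
  have x'': "((\<lambda>s. \<sigma> * ?r s) has_real_derivative - (\<psi> (x s) * \<psi>' (x s))) (at s)" if "s \<in> I" for s
  proof -
    have sq: "((\<lambda>s. 1 - (\<psi> (x s))\<^sup>2) has_real_derivative - (2 * \<psi> (x s) * (\<psi>' (x s) * (\<sigma> * ?r s)))) (at s)"
      by (auto intro!: derivative_eq_intros \<psi>x[OF that])
    have "1 - (\<psi> (x s))\<^sup>2 > 0"
      using r_pos[OF that] by simp
    from DERIV_cmult[OF DERIV_chain2[OF DERIV_real_sqrt[OF this] sq], of \<sigma>]
    have "((\<lambda>s. \<sigma> * ?r s) has_real_derivative
      \<sigma> * (inverse (?r s) / 2 * - (2 * \<psi> (x s) * (\<psi>' (x s) * (\<sigma> * ?r s))))) (at s)" .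
    also have "\<sigma> * (inverse (?r s) / 2 * - (2 * \<psi> (x s) * (\<psi>' (x s) * (\<sigma> * ?r s))))
      = - ((\<sigma> * \<sigma>) * (inverse (?r s) * ?r s) * (\<psi> (x s) * \<psi>' (x s)))"
      by (simp add: mult_ac)
    also have "\<dots> = - (\<psi> (x s) * \<psi>' (x s))"
      using r_pos[OF that] \<sigma> by simp
    finally show ?thesis .
  qed
  have t'': "((\<lambda>s. - (\<psi> (x s) * x s)) has_real_derivative 
      - ((\<psi>' (x s) * (\<sigma> * ?r s)) * x s + (\<sigma> * ?r s) * \<psi> (x s))) (at s)" if "s \<in> I" for s
    by (intro DERIV_minus DERIV_mult \<psi>x x' that)
  have cont: "isCont x s" "isCont (\<lambda>s. \<psi> (x s)) s" "isCont (\<lambda>s. \<psi>' (x s)) s" if "s \<in> I" for s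
    using DERIV_isCont[OF x'[OF that]] DERIV_isCont[OF \<psi>x[OF that]] 
      isCont_o2[OF DERIV_isCont[OF x'[OF that]] \<psi>'_isCont[OF U_pos[OF xU[OF that]]]] by auto
  interpret curve_at_level I x t c E n
  proof unfold_locales
    show "C2_on I x"
      by (rule C2_onI[OF I(1) x' x'']) (auto intro!: continuous_intros cont)
    show "C2_on I t"
      by (rule C2_onI[OF I(1) t' t'']) (auto intro!: continuous_intros cont)
    show "deriv x s \<noteq> 0 \<or> deriv t s \<noteq> 0" if "s \<in> I" for s
      using DERIV_imp_deriv[OF x'[OF that]] r_pos[OF that] \<sigma> by auto
  qed (auto intro: I U_pos xU)
  have \<zeta>: "\<zeta> s = Complex (\<sigma> * ?r s) (\<psi> (x s))" if "s \<in> I" for s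
    using x_pos[OF that] by (simp add: \<zeta>_def DERIV_imp_deriv[OF x'[OF that]] DERIV_imp_deriv[OF t'[OF that]])
  have norm: "norm (\<zeta> s) = 1" if "s \<in> I" for s
    using r_pos[OF that] \<sigma> 
    by (simp add: \<zeta>[OF that] cmod_def power_mult_distrib power2_eq_square[of \<sigma>])
  have \<nu>: "\<nu> s = Complex (\<sigma> * ?r s) (\<psi> (x s))" if "s \<in> I" for s
    using norm[OF that] by (simp add: \<nu>_conv_\<zeta> \<zeta>[OF that])
  have \<nu>': "(\<nu> has_vector_derivative \<psi>' (x s) *\<^sub>R (\<i> * \<nu> s)) (at s)" if "s \<in> I" for s
  proof (rule has_vector_derivative_eventually_eq)
    show "((\<lambda>s. of_real (\<sigma> * ?r s) + \<i> * of_real (\<psi> (x s))) has_vector_derivative \<psi>' (x s) *\<^sub>R (\<i> * \<nu> s)) (at s)"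
    proof -
      have "((\<lambda>s. of_real (\<sigma> * ?r s) + \<i> * of_real (\<psi> (x s))) has_vector_derivative
        of_real (- (\<psi> (x s) * \<psi>' (x s))) + \<i> * of_real (\<psi>' (x s) * (\<sigma> * ?r s))) (at s)"
        by (intro has_vector_derivative_add has_vector_derivative_mult_right has_vector_derivative_of_real x'' \<psi>x that)
      also have "of_real (- (\<psi> (x s) * \<psi>' (x s))) + \<i> * of_real (\<psi>' (x s) * (\<sigma> * ?r s)) = \<psi>' (x s) *\<^sub>R (\<i> * \<nu> s)"
        by (simp add: \<nu>[OF that] complex_eq_iff)
      finally show ?thesis .
    qed
    show "\<forall>\<^sub>F r in nhds s. of_real (\<sigma> * ?r r) + \<i> * of_real (\<psi> (x r)) = \<nu> r"
      using eventually_nhds_in_open[OF I(1) that] by eventually_elim (simp add: \<nu> complex_eq_iff)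
  qed
  have pmc: "p_mean_curvature I x t q = c" "energy c I x t q = E" "inv_alpha I x t q \<noteq> 0"
    if "q \<in> rot_dom I" for q :: "real \<times> (complex ^ 'n)"
  proof -
    obtain s \<omega> where q: "q = (s, \<omega>)" "s \<in> I" "norm \<omega> = 1"
      using \<open>q \<in> rot_dom I\<close> by (auto simp: rot_dom_def)
    show "p_mean_curvature I x t q = c"
      using \<psi>_ode[OF x_pos[OF q(2)]] 
      by (simp only: q(1) p_mean_curvature_eq[OF n q(2,3) \<nu>'[OF q(2)]] norm[OF q(2)]) (simp add: \<nu>[OF q(2)])
    show "energy c I x t q = E"
      by (simp add: q(1) energy_iff[OF n q(2,3)] \<nu>[OF q(2)])
    show "inv_alpha I x t q \<noteq> 0"
      using x_pos[OF q(2)] r_pos[OF q(2)] \<sigma> by (auto simp: q(1) inv_alpha_conv_\<nu>[OF q(2,3)] \<nu>[OF q(2)])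
  qed
  have "generates I x t (rot_map x t ` rot_dom I :: 'n heis set)"
    using I C2_x C2_t x_pos regular by (auto simp: generates_def)
  then show "const_pmc_energy c E I x t (rot_map x t ` rot_dom I :: 'n heis set)"
    by (simp add: const_pmc_energy_def const_pmc_def pmc)
  show "horizontal_arclength I x t"
    unfolding horizontal_arclength_def
  proof
    fix s assume "s \<in> I"
    then have "(norm (\<zeta> s))\<^sup>2 = 1" by (simp add: norm)
    then show "(deriv x s)\<^sup>2 + (deriv t s)\<^sup>2 / (x s)\<^sup>2 = 1"
      by (simp add: \<zeta>_def cmod_power2 power_divide)
  qed
  show "\<forall>q \<in> rot_dom I :: (real \<times> (complex ^ 'n)) set. inv_alpha I x t q \<noteq> 0"
    using pmc by blast
qed

lemma cylinder_curve:
  fixes x t :: "real \<Rightarrow> real"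
  assumes n: "n = CARD('n::finite)" and E: "E = E_min" and x: "\<And>s. x s = \<rho>"
    and t': "\<And>s. (t has_real_derivative - \<rho>) (at s)"
  shows "const_pmc_energy c E UNIV x t ({(z, \<tau>). norm z = \<rho>} :: 'n heis set)"
    "horizontal_arclength UNIV x t"
proof -
  have x_fun: "x = (\<lambda>s. \<rho>)" using x by auto
  have x': "(x has_real_derivative 0) (at s)" for s
    unfolding x_fun by simp
  interpret curve_at_level UNIV x t c E n
  proof unfold_locales
    show "C2_on UNIV x"
      by (rule C2_onI[where ?f1.0 = "\<lambda>_. 0" and ?f2.0 = "\<lambda>_. 0"]) (simp_all add: x')
    show "C2_on UNIV t"
      by (rule C2_onI[where ?f1.0 = "\<lambda>_. - \<rho>" and ?f2.0 = "\<lambda>_. 0"]) (simp_all add: t')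
    show "deriv x s \<noteq> 0 \<or> deriv t s \<noteq> 0" for s
      using DERIV_imp_deriv[OF t', of s] \<rho>_pos by auto
  qed (auto simp: x \<rho>_pos)
  have \<zeta>: "\<zeta> s = \<i>" for s
    using \<rho>_pos by (simp add: \<zeta>_def x DERIV_imp_deriv[OF x'] DERIV_imp_deriv[OF t'] complex_eq_iff)
  have \<nu>: "\<nu> = (\<lambda>s. \<i>)"
    by (simp add: fun_eq_iff \<nu>_conv_\<zeta> \<zeta>)
  have \<nu>': "(\<nu> has_vector_derivative 0 *\<^sub>R (\<i> * \<nu> s)) (at s)" for s
    by (simp add: \<nu>)
  have "rot_map x t ` rot_dom UNIV = ({(z, \<tau>). norm z = \<rho>} :: 'n heis set)"
  proof -
    have "\<exists>s. \<tau> = t s" for \<tau>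
    proof -
      have "((\<lambda>s. t s + \<rho> * s) has_real_derivative - \<rho> + \<rho> * 1) (at s)" for s
        by (intro DERIV_add DERIV_cmult DERIV_ident t')
      then have "t s + \<rho> * s = t 0 + \<rho> * 0" for s
        using DERIV_isconst_all[of "\<lambda>s. t s + \<rho> * s" s 0] by simp
      from this[of "(t 0 - \<tau>) / \<rho>"] show ?thesis
        using \<rho>_pos by (intro exI[of _ "(t 0 - \<tau>) / \<rho>"]) simp
    qed
    then show ?thesis
      by (subst rot_image) (simp_all add: x \<rho>_pos)
  qed
  moreover have "p_mean_curvature UNIV x t q = c" "energy c UNIV x t q = E" if "q \<in> rot_dom UNIV" for q :: "real \<times> (complex ^ 'n)"
  proof -
    obtain s \<omega> where q: "q = (s, \<omega>)" "norm \<omega> = 1"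
      using \<open>q \<in> rot_dom UNIV\<close> by (auto simp: rot_dom_def)
    show "p_mean_curvature UNIV x t q = c"
      using p_mean_curvature_eq[OF n UNIV_I q(2) \<nu>'] c_pos m_pos by (simp add: q(1) \<nu> x \<rho>_def)
    show "energy c UNIV x t q = E"
      using energy_iff[OF n UNIV_I q(2)] \<psi>_\<rho> E by (simp add: q(1) \<nu> x)
  qed
  moreover have "generates UNIV x t (rot_map x t ` rot_dom UNIV :: 'n heis set)"
    using C2_x C2_t x_pos regular by (auto simp: generates_def)
  ultimately show "const_pmc_energy c E UNIV x t ({(z, \<tau>). norm z = \<rho>} :: 'n heis set)"
    by (simp add: const_pmc_energy_def const_pmc_def)
  show "horizontal_arclength UNIV x t"
    using \<rho>_pos by (simp add: horizontal_arclength_def x DERIV_imp_deriv[OF x'] DERIV_imp_deriv[OF t'])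
qed

lemma vec_of_norm_1: "\<exists>\<omega> :: complex ^ 'n::finite. norm \<omega> = 1"
  by (rule exI[of _ "axis undefined 1"]) simp

text \<open>
  On a cylinder \<open>\<nu> = \<plusminus> \<i>\<close> is locally constant, so \<open>H = \<plusminus> m / r\<close>. Since \<open>c > 0\<close>, the sign is positive and
  the radius is \<open>\<rho>\<close>.
\<close>

lemma cylinder_unique:
  assumes n: "n = CARD('n::finite)" 
    and pmc: "const_pmc_energy c E I x t ({(z, \<tau>). norm z = r} :: 'n heis set)"
  shows "r = \<rho>" "E = E_min"
proof -
  have gen: "generates I x t ({(z, \<tau>). norm z = r} :: 'n heis set)"
    using pmc by (simp add: const_pmc_energy_def const_pmc_def)
  interpret curve_at_level I x t c E n
    using generates_generating_curve[OF gen] 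
    by (intro curve_at_level.intro energy_level_axioms)
  obtain s0 where s0: "s0 \<in> I"
    using gen by (auto simp: generates_def)
  obtain \<omega> :: "complex ^ 'n" where \<omega>: "norm \<omega> = 1"
    using vec_of_norm_1 by blast
  have x: "x s = r" if "s \<in> I" for s
  proof -
    have "{(z, \<tau>). norm z = r} = (rot_map x t ` rot_dom I :: 'n heis set)"
      using gen by (simp add: generates_def)
    moreover have "rot_map x t (s, \<omega>) \<in> rot_map x t ` rot_dom I"
      using that \<omega> by (intro imageI) (simp add: rot_dom_def)
    ultimately have "rot_map x t (s, \<omega>) \<in> {(z, \<tau>). norm z = r}"
      by metis
    then have "norm (x s *\<^sub>R \<omega>) = r"
      by (simp add: rot_map_def)
    then show ?thesis
      using x_pos[OF that] \<omega> by simp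
  qed
  have r: "r > 0"
    using x[OF s0] x_pos[OF s0] by simp
  have dx: "deriv x s = 0" if "s \<in> I" for s
    by (rule DERIV_imp_deriv, rule has_field_derivative_transform_within_open[OF DERIV_const open_I that]) (simp add: x)
  have dt: "deriv t s \<noteq> 0" if "s \<in> I" for s
    using regular[OF that] dx[OF that] by simp
  have \<zeta>: "\<zeta> s = of_real (- deriv t s / r) * \<i>" if "s \<in> I" for s
    by (simp add: \<zeta>_def dx[OF that] x[OF that] complex_eq_iff)
  have \<nu>: "\<nu> s = of_real (sgn (- deriv t s)) * \<i>" if "s \<in> I" for s
  proof -
    have "norm (\<zeta> s) = \<bar>deriv t s\<bar> / r"
      using r by (simp add: \<zeta>[OF that] norm_mult norm_divide)
    then show ?thesis
      using dt[OF that] r by (simp add: \<nu>_conv_\<zeta>) (simp add: \<zeta>[OF that] complex_eq_iff sgn_if)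
  qed
  have "continuous_on I (deriv t)"
    using C2_t by (auto simp: C2_on_def field_differentiable_imp_continuous_at intro: continuous_at_imp_continuous_on)
  then have "isCont (deriv t) s0"
    using continuous_on_eq_continuous_at[OF open_I] s0 by blast
  then have "((\<lambda>s. deriv t s * deriv t s0) \<longlongrightarrow> deriv t s0 * deriv t s0) (nhds s0)"
    by (intro tendsto_mult tendsto_const) (simp add: isCont_def tendsto_at_iff_tendsto_nhds)
  from order_tendstoD(1)[OF this, of 0]
  have "\<forall>\<^sub>F s in nhds s0. deriv t s * deriv t s0 > 0"
    using dt[OF s0] not_real_square_gt_zero[of "deriv t s0"] by blast
  then have "\<forall>\<^sub>F s in nhds s0. \<nu> s0 = \<nu> s"
    using eventually_nhds_in_open[OF open_I s0]
  proof eventually_elim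
    case (elim s)
    then have "sgn (deriv t s) = sgn (deriv t s0)"
      by (auto simp: zero_less_mult_iff)
    then show ?case
      by (simp only: \<nu>[OF s0] \<nu>[OF elim(2)] sgn_minus)
  qed
  then have "(\<nu> has_vector_derivative 0 *\<^sub>R (\<i> * \<nu> s0)) (at s0)"
    using has_vector_derivative_eventually_eq[OF has_vector_derivative_const[of "\<nu> s0"]] by simp
  then have "p_mean_curvature I x t (s0, \<omega>) = real m * (Im (\<nu> s0) / r)"
    using p_mean_curvature_eq[OF n s0 \<omega>, of 0] x[OF s0] by simp
  moreover have "(s0, \<omega>) \<in> rot_dom I"
    using s0 \<omega> by (simp add: rot_dom_def)
  then have "p_mean_curvature I x t (s0, \<omega>) = c" "energy c I x t (s0, \<omega>) = E"
    using pmc by (auto simp: const_pmc_energy_def const_pmc_def)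
  ultimately have H: "real m * (Im (\<nu> s0) / r) = c" and "Im (\<nu> s0) = \<psi> r"
    using energy_iff[OF n s0 \<omega>] x[OF s0] by simp_all
  have "Im (\<nu> s0) > 0"
  proof (rule ccontr)
    assume "\<not> Im (\<nu> s0) > 0"
    then have "real m * (Im (\<nu> s0) / r) \<le> 0"
      using r by (intro mult_nonneg_nonpos divide_nonpos_pos) auto
    then show False
      using H c_pos by simp
  qed
  then have 1: "Im (\<nu> s0) = 1"
    by (simp add: \<nu>[OF s0] sgn_if split: if_splits)
  then show "r = \<rho>"
    using H c_pos r by (simp add: \<rho>_def field_simps)
  with 1 \<open>Im (\<nu> s0) = \<psi> r\<close> show "E = E_min"
    using \<rho>_pos by (simp add: \<psi>_\<rho>)
qed

text \<open>
  Where \<open>\<alpha> \<noteq> 0\<close>, the derivative \<open>x'\<close> has a constant sign \<open>\<sigma>\<close>, so \<open>cos \<phi> = \<sigma> sqrt (1 - (\<psi> x)\<^sup>2)\<close> and \<open>t - \<sigma> h(x)\<close>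
  has derivative \<open>0\<close>.
\<close>

lemma level_curve_is_graph:
  assumes n: "n = CARD('n::finite)" 
    and pmc: "const_pmc_energy c E I x t (S :: 'n heis set)"
    and \<alpha>: "\<forall>q \<in> rot_dom I :: (real \<times> (complex ^ 'n)) set. inv_alpha I x t q \<noteq> 0"
    and h: "\<And>u. u \<in> U \<Longrightarrow> (h has_real_derivative height_slope u) (at u)"
  obtains \<sigma> k where "\<sigma> = 1 \<or> \<sigma> = - 1" "x ` I \<subseteq> U" "\<And>s. s \<in> I \<Longrightarrow> t s = \<sigma> * h (x s) + k"
proof -
  have gen: "generates I x t S"
    using pmc by (simp add: const_pmc_energy_def const_pmc_def)
  interpret curve_at_level I x t c E n
    using generates_generating_curve[OF gen] 
    by (intro curve_at_level.intro energy_level_axioms)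
  obtain \<omega> :: "complex ^ 'n" where \<omega>: "norm \<omega> = 1"
    using vec_of_norm_1 by blast
  have dom: "(s, \<omega>) \<in> rot_dom I" if "s \<in> I" for s
    using that \<omega> by (simp add: rot_dom_def)
  have Im_\<nu>: "Im (\<nu> s) = \<psi> (x s)" if "s \<in> I" for s
    using pmc dom[OF that] energy_iff[OF n that \<omega>] by (auto simp: const_pmc_energy_def)
  have Re_\<nu>: "Re (\<nu> s) \<noteq> 0" if "s \<in> I" for s
    using \<alpha> dom[OF that] by (auto simp: inv_alpha_conv_\<nu>[OF that \<omega>])
  have sq: "(Re (\<nu> s))\<^sup>2 + (\<psi> (x s))\<^sup>2 = 1" if "s \<in> I" for s
    using norm_\<nu>[OF that] by (simp add: Im_\<nu>[OF that, symmetric] cmod_power2[symmetric])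
  have xU: "x s \<in> U" if "s \<in> I" for s
  proof -
    have "(Re (\<nu> s))\<^sup>2 > 0" using Re_\<nu>[OF that] by simp
    then have "(\<psi> (x s))\<^sup>2 < 1" using sq[OF that] by linarith
    then show ?thesis
      using x_pos[OF that] by (simp add: U_def)
  qed
  have dx: "deriv x s \<noteq> 0" if "s \<in> I" for s
    using Re_\<nu>[OF that] by (auto simp: \<nu>_parts)
  have I: "is_interval I" "I \<noteq> {}" using gen by (auto simp: generates_def)
  have "continuous_on I (deriv x)"
    using C2_x by (auto simp: C2_on_def field_differentiable_imp_continuous_at intro: continuous_at_imp_continuous_on)
  then have "connected (deriv x ` I)"
    using I(1) by (intro connected_continuous_image is_interval_connected)
  then have "is_interval (deriv x ` I)"
    by (simp add: is_interval_connected_1)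
  then have "(\<forall>s\<in>I. deriv x s > 0) \<or> (\<forall>s\<in>I. deriv x s < 0)"
  proof -
    have "\<not> (deriv x s1 < 0 \<and> 0 < deriv x s2)" if "s1 \<in> I" "s2 \<in> I" for s1 s2
    proof
      assume "deriv x s1 < 0 \<and> 0 < deriv x s2"
      then have "0 \<in> deriv x ` I"
        using that \<open>is_interval (deriv x ` I)\<close> unfolding is_interval_1 by (meson imageI less_imp_le)
      then show False using dx by force
    qed
    then show ?thesis
      using dx by (meson linorder_neqE_linordered_idom)
  qed
  then obtain \<sigma> :: real where \<sigma>: "\<sigma> = 1 \<or> \<sigma> = - 1" "\<And>s. s \<in> I \<Longrightarrow> \<sigma> * deriv x s > 0"
  proof
    assume "\<forall>s\<in>I. deriv x s > 0"
    then show ?thesis by (intro that[of 1]) auto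
  next
    assume "\<forall>s\<in>I. deriv x s < 0"
    then show ?thesis by (intro that[of "- 1"]) auto
  qed
  have Re_eq: "\<sigma> * Re (\<nu> s) = sqrt (1 - (\<psi> (x s))\<^sup>2)" if "s \<in> I" for s
  proof (rule real_sqrt_unique[symmetric])
    show "(\<sigma> * Re (\<nu> s))\<^sup>2 = 1 - (\<psi> (x s))\<^sup>2"
      using sq[OF that] \<sigma>(1) by (auto simp: power_mult_distrib)
    show "0 \<le> \<sigma> * Re (\<nu> s)"
      using \<sigma>(2)[OF that] by (simp add: \<nu>_parts)
  qed
  have "((\<lambda>s. t s - \<sigma> * h (x s)) has_real_derivative 0) (at s within I)" if s: "s \<in> I" for s
  proof -
    let ?r = "sqrt (1 - (\<psi> (x s))\<^sup>2)" and ?z = "norm (\<zeta> s)"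
    have z: "?z > 0" using \<zeta>_nz[OF s] by simp
    have r: "?r > 0" using U_cont(2)[OF xU[OF s]] .
    have t': "deriv t s = - (x s * \<psi> (x s) * ?z)"
      using Im_\<nu>[OF s] z x_pos[OF s] by (simp add: \<nu>_parts field_simps)
    have x': "\<sigma> * deriv x s = ?r * ?z"
      using Re_eq[OF s] z by (simp add: \<nu>_parts field_simps)
    have "\<sigma> * (height_slope (x s) * deriv x s) = height_slope (x s) * (?r * ?z)"
      by (simp add: x'[symmetric])
    also have "\<dots> = deriv t s"
      using r by (simp add: height_slope_def t')
    finally have eq: "deriv t s - \<sigma> * (height_slope (x s) * deriv x s) = 0"
      by simp
    have "((\<lambda>s. t s - \<sigma> * h (x s)) has_real_derivative deriv t s - \<sigma> * (height_slope (x s) * deriv x s)) (at s)"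
      by (intro DERIV_diff DERIV_cmult DERIV_chain2[where g = x, OF h[OF xU[OF s]]] deriv_t deriv_x s)
    then show ?thesis
      unfolding eq by (rule has_field_derivative_at_within)
  qed
  then obtain k where k: "\<And>s. s \<in> I \<Longrightarrow> t s - \<sigma> * h (x s) = k"
    using has_field_derivative_zero_constant[of I "\<lambda>s. t s - \<sigma> * h (x s)"] I(1) is_interval_convex by blast
  have "t s = \<sigma> * h (x s) + k" if "s \<in> I" for s
    using k[OF that] by simp
  then show ?thesis
    using that \<sigma>(1) xU by blast
qed

end

section \<open>Reflective hypersurfaces\<close>

text \<open>
  The part over \<open>D\<close> of the rotationally symmetric hypersurface \<open>t = h(|z|)\<close>.
\<close>

definition radial_graph :: "real set \<Rightarrow> (real \<Rightarrow> real) \<Rightarrow> 'n::finite heis set" where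
  "radial_graph D h = {(z, \<tau>). norm z \<in> D \<and> \<tau> = h (norm z)}"

lemma t_shift_radial_graph: "t_shift k (radial_graph D h) = radial_graph D (\<lambda>u. h u + k)"
  by (force simp: t_shift_def radial_graph_def image_iff)

lemma coincides_over_range_radial_graph:
  "D' \<subseteq> D \<Longrightarrow> coincides_over_range (radial_graph D' h) (radial_graph D h)"
  by (auto simp: coincides_over_range_def radial_graph_def image_iff)

context energy_level
begin

text \<open>
  The curve is the radial graph of \<open>\<sigma> h\<close> parametrised by \<open>G\<close>, a primitive of \<open>dG/dx = \<sigma> / sqrt (1 - \<psi>\<^sup>2)\<close>, which is
  the horizontal arc-length; its inverse satisfies the equations of \<open>solution_curve\<close>.
\<close>

lemma explicit_curve_exists:
  assumes n: "n = CARD('n::finite)" and E: "E > E_min" and \<sigma>: "\<sigma> = 1 \<or> \<sigma> = - 1" and ab: "U = {a<..<b}"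
    and h: "\<And>u. u \<in> U \<Longrightarrow> (h has_real_derivative height_slope u) (at u)"
  shows "\<exists>I x t. explicit_curve n c E a b \<sigma> I x t \<and> horizontal_arclength I x t \<and>
    const_pmc_energy c E I x t (radial_graph U (\<lambda>u. \<sigma> * h u) :: 'n heis set) \<and>
    (\<forall>q \<in> rot_dom I :: (real \<times> (complex ^ 'n)) set. inv_alpha I x t q \<noteq> 0)"
proof -
  let ?r = "\<lambda>u. sqrt (1 - (\<psi> u)\<^sup>2)"
  have \<sigma>\<sigma>: "\<sigma> * \<sigma> = 1" and \<sigma>0: "\<sigma> \<noteq> 0" using \<sigma> by auto
  have "isCont (\<lambda>u. \<sigma> * (1 / ?r u)) u" if "u \<in> U" for u
    using U_cont[OF that] \<psi>_isCont[OF U_pos[OF that]] by (intro continuous_intros) auto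
  then obtain G where G: "\<And>u. u \<in> U \<Longrightarrow> (G has_real_derivative \<sigma> * (1 / ?r u)) (at u)"
    using antiderivative_on_U[OF E] by blast
  have mono: "\<sigma> * G u < \<sigma> * G v" if "u \<in> U" "v \<in> U" "u < v" for u v
  proof (rule DERIV_pos_imp_increasing[OF that(3)])
    fix w assume "u \<le> w" "w \<le> v"
    then have w: "w \<in> U"
      using is_interval_U that unfolding is_interval_1 by blast
    have "\<sigma> * (\<sigma> * (1 / ?r w)) = 1 / ?r w"
      using \<sigma>\<sigma> by (simp add: mult.assoc[symmetric])
    then show "\<exists>y. ((\<lambda>u. \<sigma> * G u) has_real_derivative y) (at w) \<and> 0 < y"
      using DERIV_cmult[OF G[OF w], of \<sigma>] U_cont(2)[OF w] by (intro exI[of _ "1 / ?r w"]) auto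
  qed
  have inj: "inj_on G U"
    by (rule linorder_inj_onI) (use mono in force)+
  have contG: "continuous_on U G"
    using G DERIV_isCont by (blast intro: continuous_at_imp_continuous_on)
  define I where "I = G ` U"
  define x where "x = the_inv_into U G"
  define t where "t s = \<sigma> * h (x s)" for s
  have xG: "x (G u) = u" if "u \<in> U" for u
    using the_inv_into_f_f[OF inj that] by (simp add: x_def)
  have xU: "x s \<in> U" if "s \<in> I" for s
    using that xG by (auto simp: I_def)
  have Gx: "G (x s) = s" if "s \<in> I" for s
    using that xG by (auto simp: I_def)
  have x': "(x has_real_derivative \<sigma> * ?r (x s)) (at s)" if s: "s \<in> I" for s
  proof -
    have "(x has_derivative (*) (\<sigma> * ?r (x s))) (at (G (x s)))"
    proof (rule has_derivative_inverse_strong[OF open_U xU[OF s] contG xG])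
      show "(G has_derivative (*) (\<sigma> * (1 / ?r (x s)))) (at (x s))"
        using G[OF xU[OF s]] by (simp add: has_field_derivative_def)
      show "(*) (\<sigma> * (1 / ?r (x s))) \<circ> (*) (\<sigma> * ?r (x s)) = id"
        using U_cont(2)[OF xU[OF s]] \<sigma>\<sigma> by (auto simp: fun_eq_iff)
    qed
    then show ?thesis
      by (simp add: has_field_derivative_def Gx[OF s])
  qed
  have t': "(t has_real_derivative - (\<psi> (x s) * x s)) (at s)" if s: "s \<in> I" for s
  proof -
    have "(t has_real_derivative \<sigma> * (height_slope (x s) * (\<sigma> * ?r (x s)))) (at s)"
      unfolding t_def by (intro DERIV_cmult DERIV_chain2[where g = x, OF h[OF xU[OF s]]] x' s)
    also have "\<sigma> * (height_slope (x s) * (\<sigma> * ?r (x s))) = (\<sigma> * \<sigma>) * (height_slope (x s) * ?r (x s))"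
      by (simp only: mult_ac)
    also have "\<dots> = - (\<psi> (x s) * x s)"
      using U_cont(2)[OF xU[OF s]] by (simp add: \<sigma>\<sigma> height_slope_def)
    finally show ?thesis .
  qed
  have I: "open I" "is_interval I" "I \<noteq> {}"
  proof -
    show "open I"
      unfolding I_def using contG open_U inj by (rule invariance_of_domain)
    show "is_interval I"
      unfolding I_def is_interval_connected_1 
      by (intro connected_continuous_image contG is_interval_connected is_interval_U)
    show "I \<noteq> {}"
      using U_nonempty[OF E] by (simp add: I_def)
  qed
  have "rot_map x t ` rot_dom I = (radial_graph U (\<lambda>u. \<sigma> * h u) :: 'n heis set)"
  proof (subst rot_image)
    show "\<And>s. s \<in> I \<Longrightarrow> x s > 0" using xU U_pos by blast
    show "{(z, \<tau>). \<exists>s\<in>I. norm z = x s \<and> \<tau> = t s} = (radial_graph U (\<lambda>u. \<sigma> * h u) :: 'n heis set)"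
      using xU xG by (fastforce simp: radial_graph_def t_def I_def)
  qed
  moreover note sol = solution_curve[where ?'n = 'n, OF n I \<sigma>\<sigma> xU x' t']
  moreover have "explicit_curve n c E a b \<sigma> I x t"
    unfolding explicit_curve_def
  proof (intro exI[of _ G] conjI ballI)
    fix u assume "u \<in> {a<..<b}"
    then have "u \<in> U" by (simp add: ab)
    moreover have "u\<^sup>2 * (E / u ^ (2 * n) - c / (2 * real n))\<^sup>2 = (\<psi> u)\<^sup>2"
      by (simp add: \<psi>_def power_mult_distrib \<Lambda>_def power2_commute)
    ultimately show "(G has_real_derivative
       \<sigma> * (1 / sqrt (1 - u\<^sup>2 * (E / u ^ (2 * n) - c / (2 * real n))\<^sup>2))) (at u)"
      using G by simp
  next
    fix s assume "s \<in> I"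
    have "\<psi> (x s) * x s = (c / (2 * real n) - E / x s ^ (2 * n)) * (x s)\<^sup>2"
      by (simp add: \<psi>_def \<Lambda>_def power2_eq_square)
    then show "(t has_real_derivative - ((c / (2 * real n) - E / x s ^ (2 * n)) * (x s)\<^sup>2)) (at s)"
      using t'[OF \<open>s \<in> I\<close>] by simp
  qed (use inj in \<open>simp_all add: ab I_def x_def\<close>)
  ultimately show ?thesis
    by (intro exI[of _ I] exI[of _ x] exI[of _ t]) simp
qed

lemma nonneg_height:
  assumes E: "E > E_min"
  obtains h where "\<And>u. u \<in> U \<Longrightarrow> (h has_real_derivative height_slope u) (at u)" "\<And>u. u \<in> U \<Longrightarrow> h u \<ge> 0"
proof -
  have "isCont height_slope u" if "u \<in> U" for u
    unfolding height_slope_def using U_cont[OF that] \<psi>_isCont[OF U_pos[OF that]]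
    by (intro continuous_intros) auto
  then obtain h where h: "\<And>u. u \<in> U \<Longrightarrow> (h has_real_derivative height_slope u) (at u)"
    using antiderivative_on_U[OF E] by blast
  obtain B where "\<And>u. u \<in> U \<Longrightarrow> B \<le> h u"
    using height_bounded_below[OF E h] by blast
  then show ?thesis
    using h by (intro that[of "\<lambda>u. h u - B"]) (auto intro!: derivative_eq_intros)
qed

lemma reflective_graphs:
  assumes n: "n = CARD('n::finite)" and E: "E > E_min"
    and h: "\<And>u. u \<in> U \<Longrightarrow> (h has_real_derivative height_slope u) (at u)" "\<And>u. u \<in> U \<Longrightarrow> h u \<ge> 0"
  shows "reflective_pmc c E (radial_graph U h :: 'n heis set) (radial_graph U (\<lambda>u. - h u))"
proof -
  obtain a b where ab: "U = {a<..<b}"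
    using U_interval[OF E] by metis
  obtain Ip xp tp where p: "const_pmc_energy c E Ip xp tp (radial_graph U h :: 'n heis set)"
    "\<forall>q \<in> rot_dom Ip :: (real \<times> (complex ^ 'n)) set. inv_alpha Ip xp tp q \<noteq> 0"
    using explicit_curve_exists[OF n E _ ab h(1), of 1] by auto
  obtain Im xm tm where m: "const_pmc_energy c E Im xm tm (radial_graph U (\<lambda>u. - h u) :: 'n heis set)"
    "\<forall>q \<in> rot_dom Im :: (real \<times> (complex ^ 'n)) set. inv_alpha Im xm tm q \<noteq> 0"
    using explicit_curve_exists[OF n E _ ab h(1), of "- 1"] by auto
  define R where "R = power2 ` U"
  define f where "f r = (h (sqrt r))\<^sup>2" for r
  have R: "(norm z)\<^sup>2 \<in> R \<longleftrightarrow> norm z \<in> U" for z :: "complex ^ 'n"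
    using U_pos by (auto simp: R_def power2_eq_iff_nonneg less_imp_le)
  have f: "norm z \<in> U \<Longrightarrow> sqrt (f ((norm z)\<^sup>2)) = h (norm z)" for z :: "complex ^ 'n"
    using h(2) by (simp add: f_def)
  have Sp: "radial_graph U h = {(z :: complex ^ 'n, \<tau>). (norm z)\<^sup>2 \<in> R \<and> \<tau> = sqrt (f ((norm z)\<^sup>2))}"
    and Sm: "radial_graph U (\<lambda>u. - h u) = {(z :: complex ^ 'n, \<tau>). (norm z)\<^sup>2 \<in> R \<and> \<tau> = - sqrt (f ((norm z)\<^sup>2))}"
    using f by (auto simp: radial_graph_def R)
  have "\<forall>r\<in>R. 0 \<le> f r"
    by (simp add: f_def)
  with p m Sp Sm show ?thesis
    unfolding reflective_pmc_def by blast
qed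

text \<open>
  \<open>Sm\<close> is the mirror image of \<open>Sp\<close>, so the description of \<open>Sp\<close> by \<open>level_curve_is_graph\<close> determines \<open>Sm\<close> too. The
  domain \<open>D\<close> may be any part of \<open>U\<close>, since a generating curve need not be maximal.
\<close>

lemma reflective_cases:
  assumes n: "n = CARD('n::finite)" and refl: "reflective_pmc c E (Sp :: 'n heis set) Sm"
    and h: "\<And>u. u \<in> U \<Longrightarrow> (h has_real_derivative height_slope u) (at u)"
  obtains (graph) D \<sigma> k where "\<sigma> = 1 \<or> \<sigma> = - 1" "D \<noteq> {}" "D \<subseteq> U"
      "Sp = radial_graph D (\<lambda>u. \<sigma> * h u + k)" "Sm = radial_graph D (\<lambda>u. - \<sigma> * h u + - k)"
  | (cylinder) "E = E_min" "Sp = {(z, \<tau>). norm z = \<rho>}" "Sm = Sp"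
  using refl unfolding reflective_pmc_def
proof (elim disjE exE conjE)
  fix R f Ip xp tp
  assume p: "const_pmc_energy c E Ip xp tp Sp"
    "\<forall>q \<in> rot_dom Ip :: (real \<times> (complex ^ 'n)) set. inv_alpha Ip xp tp q \<noteq> 0"
    and Sp: "Sp = {(z, \<tau>). (norm z)\<^sup>2 \<in> R \<and> \<tau> = sqrt (f ((norm z)\<^sup>2))}"
    and Sm: "Sm = {(z, \<tau>). (norm z)\<^sup>2 \<in> R \<and> \<tau> = - sqrt (f ((norm z)\<^sup>2))}"
  obtain \<sigma> k where \<sigma>: "\<sigma> = 1 \<or> \<sigma> = - 1" "xp ` Ip \<subseteq> U" "\<And>s. s \<in> Ip \<Longrightarrow> tp s = \<sigma> * h (xp s) + k"
    using level_curve_is_graph[OF n p h] by metis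
  have "generates Ip xp tp Sp"
    using p(1) by (simp add: const_pmc_energy_def const_pmc_def)
  then have "Ip \<noteq> {}" "\<And>s. s \<in> Ip \<Longrightarrow> xp s > 0" "Sp = rot_map xp tp ` rot_dom Ip"
    by (auto simp: generates_def)
  then have "Sp = {(z, \<tau>). \<exists>s\<in>Ip. norm z = xp s \<and> \<tau> = tp s}"
    by (simp add: rot_image)
  also have "\<dots> = radial_graph (xp ` Ip) (\<lambda>u. \<sigma> * h u + k)"
    using \<sigma>(3) by (auto simp: radial_graph_def)
  finally have Sp': "Sp = radial_graph (xp ` Ip) (\<lambda>u. \<sigma> * h u + k)" .
  have "(z, \<tau>) \<in> Sm \<longleftrightarrow> (z, - \<tau>) \<in> Sp" for z \<tau>
    by (auto simp: Sp Sm)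
  then have "(z, \<tau>) \<in> Sm \<longleftrightarrow> (z, \<tau>) \<in> radial_graph (xp ` Ip) (\<lambda>u. - \<sigma> * h u + - k)" for z \<tau>
    unfolding Sp' by (auto simp: radial_graph_def)
  then have "Sm = radial_graph (xp ` Ip) (\<lambda>u. - \<sigma> * h u + - k)"
    by auto
  then show ?thesis
    using \<open>Ip \<noteq> {}\<close> \<sigma>(1,2) Sp' by (intro graph) auto
next
  fix r I x t
  assume "Sp = {(z, \<tau>). norm z = r}" "Sm = Sp" "const_pmc_energy c E I x t Sp"
  then show ?thesis
    using cylinder_unique[OF n, of I x t r] by (intro cylinder) auto
qed

text \<open>
  The translation is by the constant \<open>k\<close> of \<open>reflective_cases\<close>. The two alternatives in \<open>same_up_to_translation\<close>
  are the signs \<open>\<sigma> = 1\<close> and \<open>\<sigma> = - 1\<close>: \<open>Sp\<close> may be the graph of \<open>h + k\<close> or of \<open>- h + k\<close> over its domain.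
\<close>

lemma reflective_unique:
  assumes n: "n = CARD('n::finite)" and E: "E > E_min" and refl: "reflective_pmc c E (Sp :: 'n heis set) Sm"
    and h: "\<And>u. u \<in> U \<Longrightarrow> (h has_real_derivative height_slope u) (at u)"
  shows "same_up_to_translation Sp Sm (radial_graph U h) (radial_graph U (\<lambda>u. - h u))"
proof (rule reflective_cases[OF n refl h])
  fix \<sigma> D k
  assume "\<sigma> = 1 \<or> \<sigma> = - 1" "D \<subseteq> U"
    "Sp = radial_graph D (\<lambda>u. \<sigma> * h u + k)" "Sm = radial_graph D (\<lambda>u. - \<sigma> * h u + - k)"
  then show ?thesis
    unfolding same_up_to_translation_def t_shift_radial_graph
    by (intro exI[of _ k]) (auto intro: coincides_over_range_radial_graph)
qed (use E in auto)

text \<open>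
  At the minimal energy \<open>\<psi> \<ge> 1\<close> everywhere, which leaves no room for \<open>\<alpha> \<noteq> 0\<close>.
\<close>

lemma reflective_unique_min:
  assumes n: "n = CARD('n::finite)" and E: "E = E_min" and refl: "reflective_pmc c E (Sp :: 'n heis set) Sm"
  shows "Sp = {(z, \<tau>). norm z = \<rho>}" "Sm = Sp"
proof -
  have "U = {}"
    using \<psi>_ge_1 U_less U_pos E by force
  then have "Sp = {(z, \<tau>). norm z = \<rho>} \<and> Sm = Sp"
    using reflective_cases[OF n refl, of "\<lambda>_. 0"] by auto
  then show "Sp = {(z, \<tau>). norm z = \<rho>}" "Sm = Sp" by auto
qed

lemma same_up_to_translation_refl: "same_up_to_translation S S' S S'"
  by (auto simp: same_up_to_translation_def coincides_over_range_def t_shift_def image_iff intro!: exI[of _ 0])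

end

theorem mainTheorem2:
  fixes c bound :: real and n :: nat
  assumes "n = CARD('n::finite)" and "c > 0"
    and "bound = - 1 / (2 * real n) * ((2 * real n - 1) / c) ^ (2 * n - 1)"
  shows
    "(\<forall>I x t (S :: 'n heis set). const_pmc c I x t S \<longrightarrow>
        (\<forall>q \<in> rot_dom I :: (real \<times> (complex ^ 'n)) set. energy c I x t q \<ge> bound)) \<and>
     (\<exists>I x t (S :: 'n heis set). const_pmc_energy c bound I x t S) \<and>
     (\<forall>E \<ge> bound. \<exists>(Sp :: 'n heis set) Sm.
        reflective_pmc c E Sp Sm \<and>
        (\<forall>Sp' Sm'. reflective_pmc c E Sp' Sm' \<longrightarrow> same_up_to_translation Sp' Sm' Sp Sm) \<and>
        (E > bound \<longrightarrow>
           (\<exists>a b. 0 \<le> a \<and> a < b \<and>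
              {u. u > 0 \<and> 1 - u\<^sup>2 * (E / u ^ (2 * n) - c / (2 * real n))\<^sup>2 > 0} = {a<..<b} \<and>
              (\<exists>I x t. explicit_curve n c E a b 1 I x t \<and> horizontal_arclength I x t \<and>
                 const_pmc_energy c E I x t Sp) \<and>
              (\<exists>I x t. explicit_curve n c E a b (- 1) I x t \<and> horizontal_arclength I x t \<and>
                 const_pmc_energy c E I x t Sm))) \<and>
        (E = bound \<longrightarrow>
           Sp = {(z, \<tau>). norm z = (2 * real n - 1) / c} \<and> Sm = Sp \<and>
           (\<exists>x t. (\<forall>s. x s = (2 * real n - 1) / c \<and>
                      (t has_real_derivative - ((c / (2 * real n) - E / x s ^ (2 * n)) * (x s)\<^sup>2)) (at s)) \<and>
                  horizontal_arclength UNIV x t \<and> const_pmc_energy c E UNIV x t Sp)))"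
proof -
  have n_pos: "n > 0" using assms(1) by simp
  have level: "energy_level c n"
    using assms(2) n_pos by unfold_locales
  define r where "r = (2 * real n - 1) / c"
  have r: "r = energy_level.\<rho> c n" and bound: "bound = energy_level.E_min c n"
    using n_pos by (simp_all add: assms(3) r_def energy_level.\<rho>_def[OF level] energy_level.E_min_def[OF level]
        energy_level.m_def[OF level] of_nat_diff)
  let ?cyl = "{(z, \<tau>). norm z = r} :: 'n heis set"
  have cyl: "const_pmc_energy c bound UNIV (\<lambda>_. r) (\<lambda>s. - r * s) ?cyl" 
    "horizontal_arclength UNIV (\<lambda>_. r) (\<lambda>s. - r * s)"
  proof -
    have "((\<lambda>s. - r * s) has_real_derivative - r) (at s)" for s
      by (auto intro!: derivative_eq_intros)
    from energy_level.cylinder_curve[OF level assms(1) bound _ this[unfolded r], folded r]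
    show "const_pmc_energy c bound UNIV (\<lambda>_. r) (\<lambda>s. - r * s) ?cyl" 
      "horizontal_arclength UNIV (\<lambda>_. r) (\<lambda>s. - r * s)" 
      by simp_all
  qed
  (* The value \<psi> \<rho> = 1 at the minimal energy, written out. *)
  have slope: "(c / (2 * real n) - bound / r ^ (2 * n)) * r\<^sup>2 = r"
  proof -
    interpret energy_level c bound n by (rule level)
    have "\<psi> r = 1" using \<psi>_\<rho> by (simp add: r bound)
    then have "\<psi> r * r = r" by simp
    then show ?thesis by (simp add: \<psi>_def \<Lambda>_def power2_eq_square mult_ac)
  qed
  show ?thesis
  proof (intro conjI allI impI ballI)
    fix I x t and S :: "'n heis set" and q :: "real \<times> (complex ^ 'n)"
    assume pmc: "const_pmc c I x t S" and q: "q \<in> rot_dom I"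
    then have "generating_curve I x t"
      by (auto simp: const_pmc_def intro: generates_generating_curve)
    (* E_min is a function of c and n alone, so any level of energy serves to enter the locale. *)
    then interpret curve_at_level I x t c 0 n
      using level by (rule curve_at_level.intro)
    show "energy c I x t q \<ge> bound"
      using energy_ge_min[OF assms(1)] q by (auto simp: rot_dom_def bound)
  next
    show "\<exists>I x t (S :: 'n heis set). const_pmc_energy c bound I x t S"
      using cyl by blast
  next
    fix E assume E: "E \<ge> bound"
    interpret energy_level c E n by (rule level)
    show "\<exists>(Sp :: 'n heis set) Sm.
        reflective_pmc c E Sp Sm \<and>
        (\<forall>Sp' Sm'. reflective_pmc c E Sp' Sm' \<longrightarrow> same_up_to_translation Sp' Sm' Sp Sm) \<and>
        (E > bound \<longrightarrow>
           (\<exists>a b. 0 \<le> a \<and> a < b \<and>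
              {u. u > 0 \<and> 1 - u\<^sup>2 * (E / u ^ (2 * n) - c / (2 * real n))\<^sup>2 > 0} = {a<..<b} \<and>
              (\<exists>I x t. explicit_curve n c E a b 1 I x t \<and> horizontal_arclength I x t \<and>
                 const_pmc_energy c E I x t Sp) \<and>
              (\<exists>I x t. explicit_curve n c E a b (- 1) I x t \<and> horizontal_arclength I x t \<and>
                 const_pmc_energy c E I x t Sm))) \<and>
        (E = bound \<longrightarrow>
           Sp = {(z, \<tau>). norm z = (2 * real n - 1) / c} \<and> Sm = Sp \<and>
           (\<exists>x t. (\<forall>s. x s = (2 * real n - 1) / c \<and>
                      (t has_real_derivative - ((c / (2 * real n) - E / x s ^ (2 * n)) * (x s)\<^sup>2)) (at s)) \<and>
                  horizontal_arclength UNIV x t \<and> const_pmc_energy c E UNIV x t Sp))"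
    proof (cases "E = bound")
      case True
      then have "E = E_min" by (simp add: bound)
      have "reflective_pmc c E ?cyl ?cyl"
        unfolding reflective_pmc_def using cyl(1) True by blast
      moreover have "\<forall>Sp' Sm'. reflective_pmc c E (Sp' :: 'n heis set) Sm' \<longrightarrow> same_up_to_translation Sp' Sm' ?cyl ?cyl"
        using reflective_unique_min[OF assms(1) \<open>E = E_min\<close>] same_up_to_translation_refl unfolding r by metis
      moreover have "\<exists>x t. (\<forall>s. x s = r \<and>
                      (t has_real_derivative - ((c / (2 * real n) - E / x s ^ (2 * n)) * (x s)\<^sup>2)) (at s)) \<and>
                  horizontal_arclength UNIV x t \<and> const_pmc_energy c E UNIV x t ?cyl"
        using cyl slope True
        by (intro exI[of _ "\<lambda>_. r"] exI[of _ "\<lambda>s. - r * s"]) (auto intro!: derivative_eq_intros)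
      ultimately show ?thesis
        using True by (intro exI[of _ ?cyl]) (simp add: r_def)
    next
      case False
      then have E: "E > E_min" using E by (simp add: bound)
      obtain h where h: "\<And>u. u \<in> U \<Longrightarrow> (h has_real_derivative height_slope u) (at u)" "\<And>u. u \<in> U \<Longrightarrow> h u \<ge> 0"
        using nonneg_height[OF E] by blast
      obtain a b where ab: "0 \<le> a" "a < b" "U = {a<..<b}"
        using U_interval[OF E] by blast
      have U: "{u. u > 0 \<and> 1 - u\<^sup>2 * (E / u ^ (2 * n) - c / (2 * real n))\<^sup>2 > 0} = {a<..<b}"
        unfolding ab(3)[symmetric] U_def \<psi>_def \<Lambda>_def
        by (simp add: power_mult_distrib power2_commute)
      have curves: "\<exists>I x t. explicit_curve n c E a b \<sigma> I x t \<and> horizontal_arclength I x t \<and>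
                 const_pmc_energy c E I x t (radial_graph U (\<lambda>u. \<sigma> * h u) :: 'n heis set)" if "\<sigma> = 1 \<or> \<sigma> = - 1" for \<sigma>
        using explicit_curve_exists[OF assms(1) E that ab(3) h(1)] by metis
      show ?thesis
        using ab(1,2) U curves[of 1] curves[of "- 1"] False
          reflective_graphs[OF assms(1) E h] reflective_unique[OF assms(1) E _ h(1)]
        by (intro exI[of _ "radial_graph U h"] exI[of _ "radial_graph U (\<lambda>u. - h u)"] conjI impI exI[of _ a] exI[of _ b]) auto
    qed
  qed
qed

end
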